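(* Let $1<p\le q<\infty$, let $\alpha=(\alpha_i)_{i\in\mathbb Z}$ be a family such that each $\alpha_i$ is a nonnegative bounded $\mathcal F_i$-measurable function, $\overline{\alpha}_i:=\sum_{j\ge i}\alpha_j\in\mathcal L^+$ for every $i\in\mathbb Z$, and $\mathcal E_i\overline{\alpha}_i\approx\overline{\alpha}_i$ for every $i\in\mathbb Z$ (with constants independent of $i$). Let $w\in\mathcal L^+$ be a weight. Then the following statements are equivalent: (a) There exists a constant $C_1>0$ such that for all $f\in L^p(d\mu)$ $$\|T_\alpha f\|_{L^q(w\,d\mu)}\le C_1\|f\|_{L^p(d\mu)};$$ (b) There exists a constant $C_2>0$ such that $$\left(\int_E\Big(\sum_{j\ge i}\alpha_j\mathcal E_jw\Big)^{p'}d\mu\right)^{1/p'}\le C_2\,\Big(\int_E w\,d\mu\Big)^{1/q'}$$ for any $E\in\mathcal F_i^0$ and any $i\in\mathbb Z$. Moreover, the least possible $C_1$ and $C_2$ are equivalent (each is at most a constant multiple of the other, with constants independent of $w$).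
   Context: $(\Omega,\mathcal F,\mu;(\mathcal F_i)_{i\in\mathbb Z})$ is a $\sigma$-finite filtered measure space: $(\Omega,\mathcal F,\mu)$ is a measure space, $\mathcal F_i\subset\mathcal F$ are sub-$\sigma$-algebras with $\mathcal F_i\subset\mathcal F_j$ whenever $i<j$, and $(\Omega,\mathcal F,\mu)$ and all $(\Omega,\mathcal F_i,\mu)$ are $\sigma$-finite. $\mathcal F_i^0$ is the collection of $E\in\mathcal F_i$ with $\mu(E)<\infty$. $\mathcal L$ is the set of $\mathcal F$-measurable $f:\Omega\to\mathbb R$ such that $1_Ef\in L^1(\mathcal F,\mu)$ for all $E\in\mathcal F_i^0$ and all $i\in\mathbb Z$. $\mathcal L^+$ is the set of nonnegative functions in $\mathcal L$, called weights. For $f\in\mathcal L$, $\mathcal E_if$ is the conditional expectation of $f$ with respect to $\mathcal F_i$: the ($\mu$-a.e. unique) $\mathcal F_i$-measurable function, integrable on every set of $\mathcal F_i^0$, with $\int_Gf\,d\mu=\int_G\mathcal E_if\,d\mu$ for all $G\in\mathcal F_i^0$. The positive operator $T_\alpha$ is $T_\alpha f:=\sum_{i\in\mathbb Z}\alpha_i\mathcal E_if$. $p'=p/(p-1)$ and $q'=q/(q-1)$ denote conjugate exponents. $A\approx B$ means $c^{-1}B\le A\le cB$ for some positive constant $c$. *)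

theory Defs
  imports "HOL-Probability.Probability"
begin

text \<open>The underlying \<sigma>-finite filtered measure space: \<open>F i\<close> only contributes its
  \<sigma>-algebra; the measure is always that of \<open>M\<close>.\<close>

locale sigma_finite_filtered_measure = sigma_finite_measure M
  for M :: "'a measure" and F :: "int \<Rightarrow> 'a measure" +
  assumes sigma_finite_sub: "\<And>i. sigma_finite_subalgebra M (F i)"
    and filtered: "\<And>i j. i < j \<Longrightarrow> sets (F i) \<subseteq> sets (F j)"

definition finite_sets :: "'a measure \<Rightarrow> 'a measure \<Rightarrow> 'a set set" where
  "finite_sets M G = {E \<in> sets G. emeasure M E < \<infinity>}"

definition loc_integrable :: "'a measure \<Rightarrow> (int \<Rightarrow> 'a measure) \<Rightarrow> ('a \<Rightarrow> real) set" where
  "loc_integrable M F =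
     {f \<in> borel_measurable M. \<forall>i. \<forall>E \<in> finite_sets M (F i). set_integrable M E f}"

definition weights :: "'a measure \<Rightarrow> (int \<Rightarrow> 'a measure) \<Rightarrow> ('a \<Rightarrow> real) set" where
  "weights M F = {f \<in> loc_integrable M F. \<forall>x \<in> space M. 0 \<le> f x}"

text \<open>The conditional expectation is the library's \<^const>\<open>real_cond_exp\<close>. The
  characterization lemmas in the library assume global integrability; the next lemma shows that on
  \<open>loc_integrable M F\<close> it is the almost everywhere unique function with the properties in
  \<open>is_cond_exp\<close>.\<close>

definition is_cond_exp :: "'a measure \<Rightarrow> 'a measure \<Rightarrow> ('a \<Rightarrow> real) \<Rightarrow> ('a \<Rightarrow> real) \<Rightarrow> bool" where
  "is_cond_exp M G f g \<longleftrightarrow> g \<in> borel_measurable G \<and>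
     (\<forall>E \<in> finite_sets M G. set_integrable M E g \<and> (LINT x:E|M. f x) = (LINT x:E|M. g x))"

lemma is_cond_exp_iff_real_cond_exp:
  fixes M :: "'a measure" and F :: "int \<Rightarrow> 'a measure"
  assumes MF: "sigma_finite_filtered_measure M F" and f: "f \<in> loc_integrable M F"
  shows "is_cond_exp M (F i) f g \<longleftrightarrow>
    g \<in> borel_measurable (F i) \<and> (AE x in M. g x = real_cond_exp M (F i) f x)"
proof -
  interpret S: sigma_finite_subalgebra M "F i"
    using MF by (rule sigma_finite_filtered_measure.sigma_finite_sub)
  have fM [measurable]: "f \<in> borel_measurable M"
    using f by (simp add: loc_integrable_def)
  have fE: "integrable M (\<lambda>x. indicator E x * f x)" if "E \<in> finite_sets M (F i)" for E
    using f that by (auto simp: loc_integrable_def set_integrable_def)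
  have sub: "E \<in> sets M" if "E \<in> sets (F i)" for E
    using S.subalg that by (auto simp: subalgebra_def)
  have meas: "h \<in> borel_measurable M" if "h \<in> borel_measurable (F i)" for h :: "'a \<Rightarrow> real"
    using S.subalg that by (rule measurable_from_subalg)
  have ce: "integrable M (\<lambda>x. indicator E x * real_cond_exp M (F i) f x)"
    "(\<integral>x. indicator E x * real_cond_exp M (F i) f x \<partial>M) = (\<integral>x. indicator E x * f x \<partial>M)"
    if E: "E \<in> finite_sets M (F i)" for E
  proof -
    have [measurable]: "E \<in> sets (F i)" using E by (simp add: finite_sets_def)
    show "integrable M (\<lambda>x. indicator E x * real_cond_exp M (F i) f x)"
      "(\<integral>x. indicator E x * real_cond_exp M (F i) f x \<partial>M) = (\<integral>x. indicator E x * f x \<partial>M)"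
      using S.real_cond_exp_intg[of "indicator E" f] fE[OF E] by auto
  qed
  show ?thesis
  proof (intro iffI conjI)
    assume g: "is_cond_exp M (F i) f g"
    then show gm [measurable]: "g \<in> borel_measurable (F i)" by (simp add: is_cond_exp_def)
    obtain A :: "nat \<Rightarrow> 'a set" where A: "range A \<subseteq> sets (restr_to_subalg M (F i))"
      "(\<Union>n. A n) = space (restr_to_subalg M (F i))"
      "\<And>n. emeasure (restr_to_subalg M (F i)) (A n) \<noteq> \<infinity>"
      using sigma_finite_measure.sigma_finite[OF S.sigma_fin_subalg] by metis
    have As [measurable]: "A n \<in> sets (F i)" for n
      using A(1) S.subalg by (auto simp: sets_restr_to_subalg)
    have Afin: "A n \<in> finite_sets M (F i)" for n
      using A(3)[of n] As[of n] S.subalg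
      by (simp add: finite_sets_def emeasure_restr_to_subalg less_top)
    have Aun: "(\<Union>n. A n) = space M"
      using A(2) by (simp add: space_restr_to_subalg)
    have "AE x in M. indicator (A n) x * g x = indicator (A n) x * real_cond_exp M (F i) f x" for n
    proof -
      have "AE x in M. real_cond_exp M (F i) (\<lambda>x. indicator (A n) x * f x) x
              = indicator (A n) x * g x"
      proof (rule S.real_cond_exp_charact)
        fix E assume E: "E \<in> sets (F i)"
        have "E \<inter> A n \<in> finite_sets M (F i)"
        proof -
          have "emeasure M (E \<inter> A n) \<le> emeasure M (A n)"
            by (rule emeasure_mono) (auto intro: sub As)
          then show ?thesis
            using E As[of n] Afin[of n] by (auto simp: finite_sets_def)
        qed
        then have "(LINT x:E \<inter> A n|M. f x) = (LINT x:E \<inter> A n|M. g x)"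
          using g by (auto simp: is_cond_exp_def)
        then show "(\<integral>x\<in>E. indicator (A n) x * f x \<partial>M) = (\<integral>x\<in>E. indicator (A n) x * g x \<partial>M)"
          by (simp add: set_lebesgue_integral_def indicator_inter_arith mult.assoc)
      next
        show "integrable M (\<lambda>x. indicator (A n) x * f x)" using fE[OF Afin] .
        show "integrable M (\<lambda>x. indicator (A n) x * g x)"
          using g Afin[of n] by (auto simp: is_cond_exp_def set_integrable_def)
        show "(\<lambda>x. indicator (A n) x * g x) \<in> borel_measurable (F i)" by measurable
      qed
      moreover have "AE x in M. real_cond_exp M (F i) (\<lambda>x. indicator (A n) x * f x) x
              = indicator (A n) x * real_cond_exp M (F i) f x"
        by (rule S.real_cond_exp_mult) (auto intro: fE[OF Afin])
      ultimately show ?thesis by eventually_elim (simp only:)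
    qed
    then have "AE x in M. \<forall>n. indicator (A n) x * g x = indicator (A n) x * real_cond_exp M (F i) f x"
      by (intro AE_all_countable[THEN iffD2] allI)
    then show "AE x in M. g x = real_cond_exp M (F i) f x"
    proof (rule AE_mp, intro AE_I2 impI)
      fix x assume x: "x \<in> space M"
        and eq: "\<forall>n. indicator (A n) x * g x = indicator (A n) x * real_cond_exp M (F i) f x"
      from x Aun obtain n where "x \<in> A n" by blast
      then show "g x = real_cond_exp M (F i) f x" using eq[rule_format, of n] by simp
    qed
  next
    assume H: "g \<in> borel_measurable (F i) \<and> (AE x in M. g x = real_cond_exp M (F i) f x)"
    then have gM [measurable]: "g \<in> borel_measurable M" using meas by blast
    have rM [measurable]: "real_cond_exp M (F i) f \<in> borel_measurable M"
      by (rule borel_measurable_cond_exp2)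
    show "is_cond_exp M (F i) f g"
      unfolding is_cond_exp_def
    proof (intro conjI ballI)
      show "g \<in> borel_measurable (F i)" using H by simp
      fix E assume E: "E \<in> finite_sets M (F i)"
      have [measurable]: "E \<in> sets M" using E sub by (simp add: finite_sets_def)
      have eq: "AE x in M. indicator E x * real_cond_exp M (F i) f x = indicator E x * g x"
        using H by auto
      have "integrable M (\<lambda>x. indicator E x * g x)"
        using integrable_cong_AE[OF _ _ eq] ce(1)[OF E] by simp
      then show "set_integrable M E g" by (simp add: set_integrable_def)
      show "(LINT x:E|M. f x) = (LINT x:E|M. g x)"
        using integral_cong_AE[OF _ _ eq] ce(2)[OF E]
        by (simp add: set_lebesgue_integral_def)
    qed
  qed
qed

text \<open>Real powers on \<open>[0, \<infinity>]\<close>, meant for positive exponents only.\<close>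

definition enn_powr :: "ennreal \<Rightarrow> real \<Rightarrow> ennreal" where
  "enn_powr x r = (if x = \<infinity> then \<infinity> else ennreal (enn2real x powr r))"

definition conj_exp :: "real \<Rightarrow> real" where
  "conj_exp p = p / (p - 1)"

definition Lp_norm :: "real \<Rightarrow> 'a measure \<Rightarrow> ('a \<Rightarrow> real) \<Rightarrow> ennreal" where
  "Lp_norm p M f = enn_powr (\<integral>\<^sup>+x. ennreal (\<bar>f x\<bar> powr p) \<partial>M) (1 / p)"

definition Lp_space :: "real \<Rightarrow> 'a measure \<Rightarrow> ('a \<Rightarrow> real) set" where
  "Lp_space p M = {f \<in> borel_measurable M. Lp_norm p M f < \<infinity>}"

definition alpha_bar :: "(int \<Rightarrow> 'a \<Rightarrow> real) \<Rightarrow> int \<Rightarrow> 'a \<Rightarrow> real" where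
  "alpha_bar \<alpha> i x = (\<Sum>\<^sub>\<infinity>j\<in>{i..}. \<alpha> j x)"

text \<open>Since \<^const>\<open>infsum\<close> is \<open>0\<close> for families that are not summable, almost
  everywhere convergence of the tails is a separate conjunct, as it is in \<open>strong_type\<close> below.
  The constant \<open>c\<close> comparing \<open>alpha_bar \<alpha> i\<close> with its conditional expectation does not depend on \<open>i\<close>.\<close>

definition admissible ::
  "'a measure \<Rightarrow> (int \<Rightarrow> 'a measure) \<Rightarrow> (int \<Rightarrow> 'a \<Rightarrow> real) \<Rightarrow> bool" where
  "admissible M F \<alpha> \<longleftrightarrow>
     (\<forall>i. \<alpha> i \<in> borel_measurable (F i) \<and> (\<forall>x \<in> space M. 0 \<le> \<alpha> i x) \<and>
          (\<exists>B. \<forall>x \<in> space M. \<alpha> i x \<le> B)) \<and>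
     (\<forall>i. (AE x in M. (\<lambda>j. \<alpha> j x) summable_on {i..}) \<and> alpha_bar \<alpha> i \<in> weights M F) \<and>
     (\<exists>c>0. \<forall>i. AE x in M.
        alpha_bar \<alpha> i x / c \<le> real_cond_exp M (F i) (alpha_bar \<alpha> i) x \<and>
        real_cond_exp M (F i) (alpha_bar \<alpha> i) x \<le> c * alpha_bar \<alpha> i x)"

definition T_op ::
  "'a measure \<Rightarrow> (int \<Rightarrow> 'a measure) \<Rightarrow> (int \<Rightarrow> 'a \<Rightarrow> real) \<Rightarrow> ('a \<Rightarrow> real) \<Rightarrow> 'a \<Rightarrow> real" where
  "T_op M F \<alpha> f x = (\<Sum>\<^sub>\<infinity>i\<in>UNIV. \<alpha> i x * real_cond_exp M (F i) f x)"

text \<open>The norm inequality for \<open>T_op\<close> includes that the series defining it converges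
  (absolutely) almost everywhere with respect to the measure \<open>w d\<mu>\<close> on the left-hand side.\<close>

definition strong_type ::
  "'a measure \<Rightarrow> (int \<Rightarrow> 'a measure) \<Rightarrow> (int \<Rightarrow> 'a \<Rightarrow> real) \<Rightarrow> real \<Rightarrow> real \<Rightarrow>
   ('a \<Rightarrow> real) \<Rightarrow> real \<Rightarrow> bool" where
  "strong_type M F \<alpha> p q w C \<longleftrightarrow>
     (\<forall>f \<in> Lp_space p M.
        (AE x in density M (\<lambda>x. ennreal (w x)). (\<lambda>i. \<alpha> i x * real_cond_exp M (F i) f x) summable_on UNIV) \<and>
        Lp_norm q (density M (\<lambda>x. ennreal (w x))) (T_op M F \<alpha> f) \<le> ennreal C * Lp_norm p M f)"

definition testing_condition ::
  "'a measure \<Rightarrow> (int \<Rightarrow> 'a measure) \<Rightarrow> (int \<Rightarrow> 'a \<Rightarrow> real) \<Rightarrow> real \<Rightarrow> real \<Rightarrow>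
   ('a \<Rightarrow> real) \<Rightarrow> real \<Rightarrow> bool" where
  "testing_condition M F \<alpha> p q w C \<longleftrightarrow>
     (\<forall>i. \<forall>E \<in> finite_sets M (F i).
        enn_powr
          (\<integral>\<^sup>+x\<in>E. enn_powr (\<Sum>\<^sub>\<infinity>j\<in>{i..}. ennreal (\<alpha> j x * real_cond_exp M (F j) w x)) (conj_exp p) \<partial>M)
          (1 / conj_exp p)
        \<le> ennreal C * enn_powr (\<integral>\<^sup>+x\<in>E. ennreal (w x) \<partial>M) (1 / conj_exp q))"

end

theory Submission
  imports Defs
begin

text \<open>By duality, the norm inequality for a nonnegative \<open>f\<close> amounts to bounding
  \<open>\<Sum>\<^sub>j \<integral> \<alpha>\<^sub>j E\<^sub>j f E\<^sub>j(g w) d\<mu>\<close> by a multiple of \<open>\<parallel>f\<parallel>\<close> in \<open>L\<^sup>p(\<mu>)\<close> times \<open>\<parallel>g\<parallel>\<close> in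
  \<open>L\<^sup>r(w d\<mu>)\<close>, where \<open>r = q'\<close> and \<open>s = p'\<close>. Write \<open>A\<^sub>k\<close> for the tail \<open>\<Sum>\<^sub>j\<^sub>\<ge>\<^sub>k \<alpha>\<^sub>j\<close>. By hypothesis \<open>A\<^sub>k\<close>
  is comparable to the \<open>F\<^sub>k\<close>-measurable \<open>\<beta>\<^sub>k = E\<^sub>k A\<^sub>k\<close>, so the tail \<open>\<Sum>\<^sub>j\<^sub>\<ge>\<^sub>k \<alpha>\<^sub>j E\<^sub>j h\<close>, which has the
  same \<open>E\<^sub>k\<close> as \<open>A\<^sub>k h\<close>, satisfies \<open>E\<^sub>k(\<Sum>\<^sub>j\<^sub>\<ge>\<^sub>k \<alpha>\<^sub>j E\<^sub>j h) \<approx> \<beta>\<^sub>k E\<^sub>k h\<close>. Stopping at the first \<open>k\<close> with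
  \<open>E\<^sub>k f > t\<close> and integrating over \<open>t\<close> bounds the bilinear form by a multiple of \<open>\<integral> f\<^sup>* N d\<mu>\<close>,
  with \<open>f\<^sup>* = sup E\<^sub>k f\<close> and \<open>N = sup \<beta>\<^sub>k E\<^sub>k(g w)\<close>; Doob's maximal inequality controls \<open>f\<^sup>*\<close>.

  Since \<open>E\<^sub>k(g w) = E\<^sub>k w \<cdot> g\<^sub>k\<close>, where \<open>g\<^sub>k\<close> is the conditional expectation of \<open>g\<close> for \<open>w d\<mu>\<close>, the same
  stopping argument applied to \<open>g\<^sub>k\<close>, together with Doob's inequality for \<open>w d\<mu>\<close> and \<open>s \<ge> r\<close>, bounds
  \<open>N\<close> in \<open>L\<^sup>s(\<mu>)\<close> once \<open>\<integral>\<^bsub>E\<^esub> sup\<^sub>j\<^sub>\<ge>\<^sub>k (\<beta>\<^sub>j E\<^sub>j w)\<^sup>s d\<mu>\<close> is at most a multiple of \<open>w(E)\<close> to the power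
  \<open>s / r\<close>, for \<open>E \<in> F\<^sub>k\<close>. By \<open>\<beta>\<^sub>j E\<^sub>j w \<lesssim> E\<^sub>j(\<Sum>\<^sub>i\<^sub>\<ge>\<^sub>k \<alpha>\<^sub>i E\<^sub>i w)\<close> and Doob's inequality, this is the
  testing condition. All steps start at a fixed time, so that stopping times are natural numbers,
  and the bounds do not depend on it. The converse follows, with the same constant, by
  moving the conditional expectations from \<open>w\<close> to a test function in \<open>L\<^sup>p(\<mu>)\<close>, since \<open>E \<in> F\<^sub>k\<close>.\<close>

section \<open>Powers, layer cake and duality in the extended nonnegative reals\<close>

lemma enn_powr_ennreal: "0 \<le> x \<Longrightarrow> enn_powr (ennreal x) r = ennreal (x powr r)"
  by (simp add: enn_powr_def)

lemma enn_powr_0 [simp]: "enn_powr 0 r = 0"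
  by (simp add: enn_powr_def)

lemma enn_powr_top [simp]: "enn_powr top r = top"
  by (simp add: enn_powr_def)

lemma enn_powr_1 [simp]: "enn_powr x 1 = x"
  by (cases x) (auto simp: enn_powr_ennreal)

lemma enn_powr_eq_0_iff [simp]: "enn_powr x r = 0 \<longleftrightarrow> x = 0"
  by (cases x) (auto simp: enn_powr_ennreal ennreal_eq_0_iff)

lemma enn_powr_eq_top_iff [simp]: "enn_powr x r = top \<longleftrightarrow> x = top"
  by (cases x) (auto simp: enn_powr_ennreal)

lemma enn_powr_less_top_iff [simp]: "enn_powr x r < top \<longleftrightarrow> x < top"
  by (simp add: less_top[symmetric])

lemma enn_powr_mono: "0 \<le> r \<Longrightarrow> x \<le> y \<Longrightarrow> enn_powr x r \<le> enn_powr y r"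
  by (cases x; cases y) (auto simp: enn_powr_ennreal powr_mono2 top_unique intro!: ennreal_leI)

lemma enn_powr_add: "enn_powr x (a + b) = enn_powr x a * enn_powr x b"
  by (cases x) (auto simp: enn_powr_ennreal powr_add ennreal_mult'' ennreal_top_mult)

lemma enn_powr_mult: "enn_powr (x * y) r = enn_powr x r * enn_powr y r"
proof (cases "x = 0 \<or> y = 0 \<or> x = top \<or> y = top")
  case False
  then show ?thesis
    by (cases x; cases y) (simp_all add: enn_powr_ennreal powr_mult flip: ennreal_mult)
qed (auto simp: ennreal_top_mult ennreal_mult_top)

lemma enn_powr_powr: "enn_powr (enn_powr x a) b = enn_powr x (a * b)"
  by (cases x) (auto simp: enn_powr_ennreal powr_powr)

lemma enn_powr_inverse_cancel [simp]:
  "r \<noteq> 0 \<Longrightarrow> enn_powr (enn_powr x r) (1 / r) = x"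
  "r \<noteq> 0 \<Longrightarrow> enn_powr (enn_powr x (1 / r)) r = x"
  by (simp_all add: enn_powr_powr)

lemma enn_powr_le_iff: "0 < r \<Longrightarrow> enn_powr x (1 / r) \<le> y \<longleftrightarrow> x \<le> enn_powr y r"
  using enn_powr_mono[of r "enn_powr x (1 / r)" y] enn_powr_mono[of "1 / r" x "enn_powr y r"]
  by auto

text \<open>For r > 0 the power is a monotone bijection whose inverse is the power 1 / r; one
  inequality is transferred through the inverse, the other is monotonicity.\<close>

lemma enn_powr_SUP:
  assumes "0 < r" "I \<noteq> {}"
  shows "enn_powr (SUP i\<in>I. f i) r = (SUP i\<in>I. enn_powr (f i) r)"
proof (rule antisym)
  have "f i \<le> enn_powr (SUP i\<in>I. enn_powr (f i) r) (1 / r)" if "i \<in> I" for i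
  proof -
    have "enn_powr (f i) r \<le> (SUP i\<in>I. enn_powr (f i) r)" by (rule SUP_upper) fact
    from enn_powr_mono[OF _ this, of "1 / r"] show ?thesis using assms by simp
  qed
  then have "(SUP i\<in>I. f i) \<le> enn_powr (SUP i\<in>I. enn_powr (f i) r) (1 / r)"
    by (rule SUP_least)
  then show "enn_powr (SUP i\<in>I. f i) r \<le> (SUP i\<in>I. enn_powr (f i) r)"
    using enn_powr_le_iff[of "1 / r"] assms by simp
  show "(SUP i\<in>I. enn_powr (f i) r) \<le> enn_powr (SUP i\<in>I. f i) r"
    using assms by (intro SUP_least enn_powr_mono SUP_upper) auto
qed

lemma borel_measurable_enn_powr [measurable]:
  assumes [measurable]: "f \<in> borel_measurable M"
  shows "(\<lambda>x. enn_powr (f x) r) \<in> borel_measurable M"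
  unfolding enn_powr_def by measurable

lemma le_suminf_ennreal: "f k \<le> (\<Sum>k. f k :: ennreal)"
  using sum_le_suminf[of f "{k}"] by simp

text \<open>With Y the full sum, the power u of \<open>y k\<close> is at most \<open>y k\<close>
  times Y to the power u - 1. Applied with u = p' / q', this is one of the places where p <= q
  enters.\<close>

lemma enn_powr_suminf_superadditive:
  assumes "1 \<le> u"
  shows "(\<Sum>k. enn_powr (y k) u) \<le> enn_powr (\<Sum>k. y k) u"
proof -
  have "y k \<le> (\<Sum>k. y k)" for k
    by (rule le_suminf_ennreal)
  then have "enn_powr (y k) u \<le> y k * enn_powr (\<Sum>k. y k) (u - 1)" for k
    using enn_powr_add[of "y k" 1 "u - 1"] assms by (auto intro!: mult_left_mono enn_powr_mono)
  then have "(\<Sum>k. enn_powr (y k) u) \<le> (\<Sum>k. y k * enn_powr (\<Sum>k. y k) (u - 1))"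
    by (intro suminf_le) auto
  also have "\<dots> = enn_powr (\<Sum>k. y k) u"
    using enn_powr_add[of "\<Sum>k. y k" 1 "u - 1"] by simp
  finally show ?thesis .
qed

section \<open>Young's and Hoelder's inequalities\<close>

lemma ennreal_Youngs_inequality:
  assumes "1 < p" "1 < q" "1 / p + 1 / q = 1"
  shows "x * y \<le> ennreal (1 / p) * enn_powr x p + ennreal (1 / q) * enn_powr y q"
proof (cases "x = top \<or> y = top")
  case True
  then show ?thesis using assms by (auto simp: ennreal_mult_top)
next
  case False
  then show ?thesis
    using Youngs_inequality[OF assms, of "enn2real x" "enn2real y"] assms
    by (cases x; cases y) (auto simp: enn_powr_ennreal simp flip: ennreal_mult ennreal_plus)
qed

text \<open>Both factors are normalised and Young's inequality is integrated, which requires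
  positive finite norms. If one power integral is 0, the product vanishes almost everywhere; if one
  is infinite and neither is 0, the right-hand side is infinite.\<close>

lemma nn_integral_Holder:
  assumes pq: "1 < p" "1 < q" "1 / p + 1 / q = 1"
    and [measurable]: "f \<in> borel_measurable M" "g \<in> borel_measurable M"
  shows "(\<integral>\<^sup>+x. f x * g x \<partial>M) \<le>
    enn_powr (\<integral>\<^sup>+x. enn_powr (f x) p \<partial>M) (1 / p) * enn_powr (\<integral>\<^sup>+x. enn_powr (g x) q \<partial>M) (1 / q)"
    (is "_ \<le> enn_powr ?F _ * enn_powr ?G _")
proof -
  consider "?F = 0 \<or> ?G = 0" | "?F \<noteq> 0" "?G \<noteq> 0" "?F = top \<or> ?G = top"
    | "?F \<noteq> 0" "?G \<noteq> 0" "?F \<noteq> top" "?G \<noteq> top" by blast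
  then show ?thesis
  proof cases
    case 1
    then have "AE x in M. f x * g x = 0"
      by (auto simp: nn_integral_0_iff_AE elim!: eventually_mono)
    then have "(\<integral>\<^sup>+x. f x * g x \<partial>M) = 0"
      by (simp add: nn_integral_0_iff_AE)
    then show ?thesis by simp
  next
    case 2
    then show ?thesis by (auto simp: ennreal_top_mult ennreal_mult_top)
  next
    case 3
    define a b where "a = enn_powr ?F (1 / p)" and "b = enn_powr ?G (1 / q)"
    have ab: "a \<noteq> 0" "a < top" "b \<noteq> 0" "b < top"
      using 3 by (auto simp: a_def b_def less_top)
    have aF: "enn_powr a p = ?F" "enn_powr b q = ?G"
      using pq by (auto simp: a_def b_def)
    have inv: "inverse a * a = 1" "inverse b * b = 1"
      using ab by (auto simp: mult.commute[of "inverse _"] simp flip: divide_ennreal_def)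
    have ia: "enn_powr (inverse a) p * ?F = 1" "enn_powr (inverse b) q * ?G = 1"
      unfolding aF[symmetric] enn_powr_mult[symmetric] inv by (auto simp: enn_powr_def)
    have "(\<integral>\<^sup>+x. (inverse a * f x) * (inverse b * g x) \<partial>M)
      \<le> (\<integral>\<^sup>+x. ennreal (1 / p) * enn_powr (inverse a * f x) p
            + ennreal (1 / q) * enn_powr (inverse b * g x) q \<partial>M)"
      by (intro nn_integral_mono ennreal_Youngs_inequality pq)
    also have "\<dots> = ennreal (1 / p) * (enn_powr (inverse a) p * ?F) + ennreal (1 / q) * (enn_powr (inverse b) q * ?G)"
      by (simp add: nn_integral_add nn_integral_cmult enn_powr_mult)
    also have "\<dots> = 1"
      unfolding ia using pq by (simp flip: ennreal_plus)
    finally have le: "(\<integral>\<^sup>+x. (inverse a * f x) * (inverse b * g x) \<partial>M) \<le> 1" .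
    have "(\<integral>\<^sup>+x. f x * g x \<partial>M) = (\<integral>\<^sup>+x. (inverse a * a) * (inverse b * b) * (f x * g x) \<partial>M)"
      unfolding inv by simp
    also have "\<dots> = (\<integral>\<^sup>+x. (a * b) * ((inverse a * f x) * (inverse b * g x)) \<partial>M)"
      by (simp only: ac_simps)
    also have "\<dots> = (a * b) * (\<integral>\<^sup>+x. (inverse a * f x) * (inverse b * g x) \<partial>M)"
      by (rule nn_integral_cmult) measurable
    also have "\<dots> \<le> a * b"
      using mult_left_mono[OF le, of "a * b"] by simp
    finally show ?thesis by (simp add: a_def b_def)
  qed
qed

section \<open>Layer cake formula\<close>

lemma nn_integral_power_layer:
  assumes "0 < e"
  shows "(\<integral>\<^sup>+t. indicator {0<..} t * indicator {t. ennreal t < x} t * ennreal (e * t powr (e - 1)) \<partial>lborel)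
    = enn_powr x e"
proof -
  have fin: "(\<integral>\<^sup>+t. indicator {0<..} t * indicator {t. ennreal t < ennreal b} t * ennreal (e * t powr (e - 1)) \<partial>lborel)
    = ennreal (b powr e)" if "0 \<le> b" for b
  proof -
    have "((\<lambda>t. e * t powr (e - 1)) has_integral (e * (b powr (e - 1 + 1) / (e - 1 + 1)))) {0..b}"
      by (intro has_integral_mult_right has_integral_powr_from_0) (use assms that in auto)
    then have "(\<integral>\<^sup>+t. ennreal (indicator {0..b} t * (e * t powr (e - 1))) \<partial>lborel) = ennreal (b powr e)"
      using assms nn_integral_has_integral_lebesgue[of "{0..b}" "\<lambda>t. e * t powr (e - 1)"] by simp
    moreover have "(\<integral>\<^sup>+t. indicator {0<..} t * indicator {t. ennreal t < ennreal b} t * ennreal (e * t powr (e - 1)) \<partial>lborel)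
        = (\<integral>\<^sup>+t. ennreal (indicator {0..b} t * (e * t powr (e - 1))) \<partial>lborel)"
    proof (rule nn_integral_cong_AE)
      \<comment> \<open>The level condition is strict at b while the interval is closed, hence
        equality only off a null set.\<close>
      have "AE t in lborel. t \<notin> {0, b}"
        by (rule AE_not_in, rule finite_imp_null_set_lborel) simp
      then show "AE t in lborel. indicator {0<..} t * indicator {t. ennreal t < ennreal b} t * ennreal (e * t powr (e - 1))
          = ennreal (indicator {0..b} t * (e * t powr (e - 1)))"
        by eventually_elim (auto simp: indicator_def ennreal_less_iff)
    qed
    ultimately show ?thesis by simp
  qed
  show ?thesis
  proof (cases x)
    case (real b)
    then show ?thesis using fin[of b] by (simp add: enn_powr_ennreal)
  next
    case top
    let ?I = "\<integral>\<^sup>+t. indicator {0<..} t * indicator {t. ennreal t < x} t * ennreal (e * t powr (e - 1)) \<partial>lborel"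
    have le: "ennreal (b powr e) \<le> ?I" if "0 \<le> b" for b
      unfolding fin[OF that, symmetric] top
      by (intro nn_integral_mono mult_right_mono mult_left_mono) (auto split: split_indicator)
    \<comment> \<open>An infinite x exceeds every level; the cut-off
      \<open>real n powr (1 / e)\<close> has e-th power n.\<close>
    have "of_nat n \<le> ?I" for n
      using le[of "real n powr (1 / e)"] assms by (simp add: powr_powr ennreal_of_nat_eq_real_of_nat)
    then have "(SUP n. of_nat n) \<le> ?I" by (rule SUP_least)
    then show ?thesis using top by (simp add: ennreal_SUP_of_nat_eq_top top_unique)
  qed
qed

text \<open>Tonelli's theorem applied to the formula for a single value. The weight \<open>c\<close>
  makes it usable for Carleson sums and, with \<open>c\<close> the function itself, in the maximal
  inequality.\<close>

lemma (in sigma_finite_measure) nn_integral_layer_cake: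
  fixes f c :: "'a \<Rightarrow> ennreal"
  assumes [measurable]: "f \<in> borel_measurable M" "c \<in> borel_measurable M" and "0 < e"
  shows "(\<integral>\<^sup>+x. c x * enn_powr (f x) e \<partial>M) =
    (\<integral>\<^sup>+t. indicator {0<..} t * ennreal (e * t powr (e - 1)) * (\<integral>\<^sup>+x. c x * indicator {x. ennreal t < f x} x \<partial>M) \<partial>lborel)"
proof -
  interpret pair_sigma_finite M lborel
    by (rule pair_sigma_finite.intro) (rule sigma_finite_measure_axioms, rule lborel.sigma_finite_measure_axioms)
  \<comment> \<open>The level condition appears as an \<open>if\<close>, in which form joint
    measurability in x and t is accessible.\<close>
  define h where "h = (\<lambda>x t. c x * (indicator {0<..} t * (if ennreal t < f x then 1 else 0) * ennreal (e * t powr (e - 1))))"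
  have [measurable]: "case_prod h \<in> borel_measurable (M \<Otimes>\<^sub>M lborel)"
    unfolding h_def by measurable
  have "(\<integral>\<^sup>+x. c x * enn_powr (f x) e \<partial>M) = (\<integral>\<^sup>+x. (\<integral>\<^sup>+t. h x t \<partial>lborel) \<partial>M)"
  proof (rule nn_integral_cong)
    fix x
    have "enn_powr (f x) e = (\<integral>\<^sup>+t. indicator {0<..} t * indicator {t. ennreal t < f x} t * ennreal (e * t powr (e - 1)) \<partial>lborel)"
      by (rule nn_integral_power_layer[symmetric]) fact
    also have "\<dots> = (\<integral>\<^sup>+t. indicator {0<..} t * (if ennreal t < f x then 1 else 0) * ennreal (e * t powr (e - 1)) \<partial>lborel)"
      by (intro nn_integral_cong) (auto split: split_indicator)
    finally show "c x * enn_powr (f x) e = (\<integral>\<^sup>+t. h x t \<partial>lborel)"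
      unfolding h_def by (subst nn_integral_cmult) auto
  qed
  also have "\<dots> = (\<integral>\<^sup>+t. (\<integral>\<^sup>+x. h x t \<partial>M) \<partial>lborel)"
    by (rule Fubini'[symmetric]) measurable
  also have "\<dots> = (\<integral>\<^sup>+t. indicator {0<..} t * ennreal (e * t powr (e - 1)) * (\<integral>\<^sup>+x. c x * indicator {x. ennreal t < f x} x \<partial>M) \<partial>lborel)"
  proof (rule nn_integral_cong)
    fix t :: real
    have [measurable]: "(\<lambda>x. c x * indicator {x. ennreal t < f x} x) \<in> borel_measurable M"
    proof -
      have "(\<lambda>x. c x * indicator {x. ennreal t < f x} x) = (\<lambda>x. c x * (if ennreal t < f x then 1 else 0))"
        by (auto split: split_indicator)
      then show ?thesis by simp
    qed
    have "(\<integral>\<^sup>+x. h x t \<partial>M) = (\<integral>\<^sup>+x. (indicator {0<..} t * ennreal (e * t powr (e - 1))) * (c x * indicator {x. ennreal t < f x} x) \<partial>M)"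
      by (intro nn_integral_cong) (auto simp: h_def mult_ac split: split_indicator)
    also have "\<dots> = indicator {0<..} t * ennreal (e * t powr (e - 1)) * (\<integral>\<^sup>+x. c x * indicator {x. ennreal t < f x} x \<partial>M)"
      by (rule nn_integral_cmult) measurable
    finally show "(\<integral>\<^sup>+x. h x t \<partial>M) = \<dots>" .
  qed
  finally show ?thesis .
qed

lemma (in sigma_finite_measure) borel_measurable_nn_integral_superlevel:
  fixes f c :: "'a \<Rightarrow> ennreal"
  assumes [measurable]: "f \<in> borel_measurable M" "c \<in> borel_measurable M"
  shows "(\<lambda>t::real. \<integral>\<^sup>+x. c x * indicator {x. ennreal t < f x} x \<partial>M) \<in> borel_measurable borel"
proof -
  have "(\<lambda>t::real. \<integral>\<^sup>+x. c x * indicator {x. ennreal t < f x} x \<partial>M)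
    = (\<lambda>t. \<integral>\<^sup>+x. c x * (if ennreal t < f x then 1 else 0) \<partial>M)"
    by (intro ext nn_integral_cong) (auto split: split_indicator)
  moreover have "(\<lambda>t::real. \<integral>\<^sup>+x. c x * (if ennreal t < f x then 1 else 0) \<partial>M) \<in> borel_measurable borel"
    by measurable
  ultimately show ?thesis by simp
qed

text \<open>The extremal test function is U to the power q - 1. Since U may be infinite or have
  infinite norm, this is done for truncations in height and support, and monotone convergence
  removes them; finiteness of the norm of U is never presupposed.\<close>

lemma (in sigma_finite_measure) Lp_norm_le_by_duality:
  fixes U :: "'a \<Rightarrow> ennreal"
  assumes [measurable]: "U \<in> borel_measurable M" and q: "1 < q"
    and test: "\<And>g :: 'a \<Rightarrow> real. g \<in> borel_measurable M \<Longrightarrow> (\<And>x. 0 \<le> g x) \<Longrightarrow>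
      (\<integral>\<^sup>+x. enn_powr (ennreal (g x)) (conj_exp q) \<partial>M) < top \<Longrightarrow>
      (\<integral>\<^sup>+x. U x * ennreal (g x) \<partial>M)
        \<le> C * enn_powr (\<integral>\<^sup>+x. enn_powr (ennreal (g x)) (conj_exp q) \<partial>M) (1 / conj_exp q)"
  shows "enn_powr (\<integral>\<^sup>+x. enn_powr (U x) q \<partial>M) (1 / q) \<le> C"
proof -
  obtain A :: "nat \<Rightarrow> 'a set" where A: "range A \<subseteq> sets M" "(\<Union>n. A n) = space M"
    "\<And>n. emeasure M (A n) \<noteq> \<infinity>" "incseq A"
    using sigma_finite_incseq by blast
  have [measurable]: "A n \<in> sets M" for n using A by auto
  define v where "v n x = enn2real (min (U x) (of_nat n)) * indicator (A n) x" for n x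
  have [measurable]: "v n \<in> borel_measurable M" for n unfolding v_def by measurable
  have v0: "0 \<le> v n x" for n x by (simp add: v_def)
  have fin: "min (U x) (of_nat n) < top" for x n
    by (simp add: min_less_iff_disj of_nat_less_top)
  have v: "ennreal (v n x) = min (U x) (of_nat n) * indicator (A n) x" for n x
    using fin by (auto simp: v_def split: split_indicator)
  have bound: "(\<integral>\<^sup>+x. enn_powr (v n x) q \<partial>M) \<le> enn_powr C q" for n
  proof -
    let ?I = "\<integral>\<^sup>+x. enn_powr (v n x) q \<partial>M"
    \<comment> \<open>Since (q - 1) q' = q, the conjugate power of g is the q-th power of
      \<open>v n\<close>. As \<open>?I\<close> is finite, its power 1 / q' can be cancelled
      below.\<close>
    define g where "g = (\<lambda>x. v n x powr (q - 1))"
    have g [measurable]: "g \<in> borel_measurable M" unfolding g_def by measurable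
    have gq: "enn_powr (ennreal (g x)) (conj_exp q) = enn_powr (v n x) q" for x
      using q by (simp add: g_def v0 enn_powr_ennreal powr_powr conj_exp_def)
    have "enn_powr (v n x) q \<le> enn_powr (of_nat n) q * indicator (A n) x" for x
      using q by (auto simp: v enn_powr_mono split: split_indicator)
    then have "?I \<le> (\<integral>\<^sup>+x. enn_powr (of_nat n) q * indicator (A n) x \<partial>M)"
      by (intro nn_integral_mono)
    also have "\<dots> = enn_powr (of_nat n) q * emeasure M (A n)"
      by (simp add: nn_integral_cmult_indicator)
    also have "\<dots> < top"
      using A(3)[of n] by (auto simp: ennreal_mult_eq_top_iff less_top[symmetric])
    finally have I: "?I < top" .
    have "?I \<le> (\<integral>\<^sup>+x. U x * ennreal (g x) \<partial>M)"
    proof (rule nn_integral_mono)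
      fix x
      have "ennreal (v n x) \<le> U x" by (auto simp: v split: split_indicator)
      moreover have "enn_powr (v n x) q = v n x * enn_powr (v n x) (q - 1)"
        using enn_powr_add[of "v n x" 1 "q - 1"] by simp
      ultimately show "enn_powr (v n x) q \<le> U x * ennreal (g x)"
        by (simp add: g_def v0 enn_powr_ennreal mult_right_mono)
    qed
    also have "\<dots> \<le> C * enn_powr ?I (1 / conj_exp q)"
      using test[OF g] I unfolding gq by (simp add: g_def)
    finally have le: "?I \<le> C * enn_powr ?I (1 / conj_exp q)" .
    have c: "1 / q + 1 / conj_exp q = 1"
      using q by (simp add: conj_exp_def field_simps)
    have "enn_powr ?I (1 / q) \<le> C"
    proof (cases "?I = 0")
      case False
      have "enn_powr ?I (1 / conj_exp q) * enn_powr ?I (1 / q) \<le> enn_powr ?I (1 / conj_exp q) * C"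
        using le enn_powr_add[of ?I "1 / q" "1 / conj_exp q"] unfolding c by (simp add: mult.commute)
      then show ?thesis
        using False I by (subst (asm) ennreal_mult_le_mult_iff) auto
    qed simp
    then show ?thesis using q by (simp add: enn_powr_le_iff)
  qed
  have "incseq (\<lambda>n x. enn_powr (v n x) q)"
  proof (intro incseq_SucI le_funI enn_powr_mono)
    fix n x
    have "indicator (A n) x \<le> (indicator (A (Suc n)) x :: ennreal)"
      using incseq_SucD[OF A(4), of n] by (auto split: split_indicator)
    moreover have "of_nat n \<le> (of_nat (Suc n) :: ennreal)"
      by (intro of_nat_mono) simp
    ultimately show "ennreal (v n x) \<le> ennreal (v (Suc n) x)"
      unfolding v by (intro mult_mono min.mono) auto
  qed (use q in auto)
  then have "(\<integral>\<^sup>+x. (SUP n. enn_powr (v n x) q) \<partial>M) = (SUP n. \<integral>\<^sup>+x. enn_powr (v n x) q \<partial>M)"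
    by (intro nn_integral_monotone_convergence_SUP) auto
  also have "\<dots> \<le> enn_powr C q" by (rule SUP_least) (rule bound)
  finally have le: "(\<integral>\<^sup>+x. (SUP n. enn_powr (v n x) q) \<partial>M) \<le> enn_powr C q" .
  have sup: "U x \<le> (SUP n. ennreal (v n x))" if "x \<in> space M" for x
  proof -
    have "x \<in> (\<Union>n. A n)" using that by (simp only: A(2))
    then obtain m where m: "x \<in> A m" by (rule UN_E)
    have mem: "x \<in> A n" if "m \<le> n" for n
      using m incseqD[OF A(4) that] by auto
    show ?thesis
    \<comment> \<open>If \<open>U x\<close> is infinite, no truncation attains it; but each y <
      \<open>U x\<close> is finite and lies below one. The index \<open>max m n\<close> also puts x
      into the exhausting set.\<close>
    proof (rule dense_le)
      fix y assume y: "y < U x"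
      then have "y < top" by (rule less_le_trans) simp
      then obtain n where n: "y < of_nat n" using ennreal_Ex_less_of_nat by blast
      have "of_nat n \<le> (of_nat (max m n) :: ennreal)" by (intro of_nat_mono) simp
      with n have "y \<le> of_nat (max m n)" by (meson less_imp_le order_trans)
      then have "y \<le> ennreal (v (max m n) x)"
        unfolding v using y mem[of "max m n"] by auto
      also have "\<dots> \<le> (SUP n. ennreal (v n x))" by (rule SUP_upper) simp
      finally show "y \<le> (SUP n. ennreal (v n x))" .
    qed
  qed
  have "(\<integral>\<^sup>+x. enn_powr (U x) q \<partial>M) \<le> (\<integral>\<^sup>+x. (SUP n. enn_powr (v n x) q) \<partial>M)"
  proof (rule nn_integral_mono)
    fix x assume "x \<in> space M"
    then have "enn_powr (U x) q \<le> enn_powr (SUP n. ennreal (v n x)) q"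
      using q by (intro enn_powr_mono sup) auto
    also have "\<dots> = (SUP n. enn_powr (v n x) q)"
      using q by (intro enn_powr_SUP) auto
    finally show "enn_powr (U x) q \<le> (SUP n. enn_powr (v n x) q)" .
  qed
  with le show ?thesis using q by (simp add: enn_powr_le_iff)
qed

section \<open>Stopping times: Carleson embeddings and the maximal inequality\<close>

text \<open>Times are natural numbers, so that every nonempty set of times has a first element; the
  instances are \<open>F (i + int n)\<close> for fixed i.\<close>

locale nat_filtration =
  fixes M :: "'a measure" and G :: "nat \<Rightarrow> 'a measure"
  assumes subalg: "\<And>n. sigma_finite_subalgebra M (G n)"
    and sets_mono: "\<And>m n. m \<le> n \<Longrightarrow> sets (G m) \<subseteq> sets (G n)"
begin

sublocale sigma_finite_measure M
  using subalg[of 0] by (rule sigma_finite_subalgebra_is_sigma_finite)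

lemma space_G [simp]: "space (G n) = space M"
  using sigma_finite_subalgebra.subalg[OF subalg, of n] by (simp add: subalgebra_def)

lemma sets_G_imp_sets: "E \<in> sets (G n) \<Longrightarrow> E \<in> sets M"
  using sigma_finite_subalgebra.subalg[OF subalg, of n] by (auto simp: subalgebra_def)

lemma measurable_G_imp: "f \<in> measurable (G n) N \<Longrightarrow> f \<in> measurable M N"
  by (rule measurable_from_subalg[OF sigma_finite_subalgebra.subalg[OF subalg]])

lemma measurable_G_mono: "m \<le> n \<Longrightarrow> f \<in> measurable (G m) N \<Longrightarrow> f \<in> measurable (G n) N"
  by (rule measurable_from_subalg) (auto simp: subalgebra_def sets_mono)

lemma set_nn_integral_cond_exp:
  assumes [measurable]: "E \<in> sets (G n)" "f \<in> borel_measurable M"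
  shows "(\<integral>\<^sup>+x\<in>E. nn_cond_exp M (G n) f x \<partial>M) = (\<integral>\<^sup>+x\<in>E. f x \<partial>M)"
  using sigma_finite_subalgebra.nn_cond_exp_intg[OF subalg, of "indicator E" n f]
  by (simp add: mult.commute)

text \<open>The event that the stopping time "first n with t < a n" equals k.\<close>

definition first_above :: "(nat \<Rightarrow> 'a \<Rightarrow> ennreal) \<Rightarrow> ennreal \<Rightarrow> nat \<Rightarrow> 'a set" where
  "first_above a t k = {x \<in> space M. t < a k x \<and> (\<forall>j<k. \<not> t < a j x)}"

lemma first_above_sets:
  assumes "\<And>n. a n \<in> borel_measurable (G n)"
  shows "first_above a t k \<in> sets (G k)"
proof -
  have m: "{x \<in> space (G k). t < a j x} \<in> sets (G k)" if "j \<le> k" for j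
  proof -
    have [measurable]: "a j \<in> borel_measurable (G k)" using measurable_G_mono[OF that assms] .
    show ?thesis by measurable
  qed
  have "first_above a t k = {x \<in> space (G k). t < a k x} - (\<Union>j<k. {x \<in> space (G k). t < a j x})"
    by (auto simp: first_above_def)
  then show ?thesis
    by (simp only:) (intro sets.Diff sets.finite_UN m; simp)
qed

lemma disjoint_first_above: "disjoint_family (first_above a t)"
  unfolding disjoint_family_on_def first_above_def
  by (auto, metis linorder_neqE_nat)

lemma UN_first_above: "(\<Union>k. first_above a t k) = {x \<in> space M. t < (SUP n. a n x)}"
proof (intro set_eqI iffI)
  fix x assume "x \<in> {x \<in> space M. t < (SUP n. a n x)}"
  then have x: "x \<in> space M" and "\<exists>n. t < a n x" by (auto simp: less_SUP_iff)
  then obtain k where "t < a k x" "\<forall>j<k. \<not> t < a j x"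
    using exists_least_iff[of "\<lambda>n. t < a n x"] by blast
  with x show "x \<in> (\<Union>k. first_above a t k)" by (auto simp: first_above_def)
qed (auto simp: first_above_def less_SUP_iff)

text \<open>The set where the supremum exceeds t is the union of the stopping events, so a function
  vanishing off it can be bounded event by event, with a bound depending on the stopping time. Both
  embeddings below rest on this.\<close>

lemma nn_integral_stopping_le:
  assumes a: "\<And>n. a n \<in> borel_measurable (G n)"
    and R [measurable]: "\<And>k. R k \<in> borel_measurable M"
    and le: "\<And>x k. x \<in> first_above a t k \<Longrightarrow> \<Phi> x \<le> R k x"
    and zero: "\<And>x. x \<in> space M \<Longrightarrow> \<not> t < (SUP n. a n x) \<Longrightarrow> \<Phi> x = 0"
  shows "(\<integral>\<^sup>+x. \<Phi> x \<partial>M) \<le> (\<Sum>k. \<integral>\<^sup>+x\<in>first_above a t k. R k x \<partial>M)"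
proof -
  have [measurable]: "first_above a t k \<in> sets M" for k
    using first_above_sets[OF a] by (rule sets_G_imp_sets)
  have "\<Phi> x \<le> (\<Sum>k. R k x * indicator (first_above a t k) x)" if x: "x \<in> space M" for x
  proof (cases "t < (SUP n. a n x)")
    case True
    with x obtain k where k: "x \<in> first_above a t k"
      using UN_first_above[of a t] by blast
    have "\<Phi> x \<le> R k x * indicator (first_above a t k) x" using le[OF k] k by simp
    also have "\<dots> \<le> (\<Sum>k. R k x * indicator (first_above a t k) x)"
      by (rule le_suminf_ennreal)
    finally show ?thesis .
  qed (simp add: zero x)
  then have "(\<integral>\<^sup>+x. \<Phi> x \<partial>M) \<le> (\<integral>\<^sup>+x. (\<Sum>k. R k x * indicator (first_above a t k) x) \<partial>M)"
    by (rule nn_integral_mono)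
  also have "\<dots> = (\<Sum>k. \<integral>\<^sup>+x\<in>first_above a t k. R k x \<partial>M)"
    by (rule nn_integral_suminf) measurable
  finally show ?thesis .
qed

lemma suminf_set_nn_integral_first_above:
  assumes a: "\<And>n. a n \<in> borel_measurable (G n)" and [measurable]: "f \<in> borel_measurable M"
  shows "(\<Sum>k. \<integral>\<^sup>+x\<in>first_above a t k. f x \<partial>M) = (\<integral>\<^sup>+x. f x * indicator {x. t < (SUP n. a n x)} x \<partial>M)"
proof -
  have [measurable]: "first_above a t k \<in> sets M" for k
    using first_above_sets[OF a] by (rule sets_G_imp_sets)
  have "(\<Sum>k. \<integral>\<^sup>+x\<in>first_above a t k. f x \<partial>M) = (\<integral>\<^sup>+x. (\<Sum>k. f x * indicator (first_above a t k) x) \<partial>M)"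
    by (rule nn_integral_suminf[symmetric]) measurable
  also have "\<dots> = (\<integral>\<^sup>+x. f x * indicator {x. t < (SUP n. a n x)} x \<partial>M)"
  proof (rule nn_integral_cong)
    fix x assume "x \<in> space M"
    then have "indicator {x. t < (SUP n. a n x)} x = (indicator (\<Union>k. first_above a t k) x :: ennreal)"
      unfolding UN_first_above by (simp add: indicator_def)
    then show "(\<Sum>k. f x * indicator (first_above a t k) x) = f x * indicator {x. t < (SUP n. a n x)} x"
      using suminf_indicator[OF disjoint_first_above, of a t x] by simp
  qed
  finally show ?thesis .
qed

text \<open>A Carleson embedding. At level t the terms before the stopping time vanish, so the sum
  is at most its tail from that time on, and \<open>test\<close> applies because
  \<open>first_above a t k\<close> lies in \<open>G k\<close>. Integration over t gives the
  claim.\<close>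

lemma nn_integral_Carleson:
  assumes a: "\<And>n. a n \<in> borel_measurable (G n)"
    and [measurable]: "\<And>n. c n \<in> borel_measurable M" "N \<in> borel_measurable M"
    and test: "\<And>k E. E \<in> sets (G k) \<Longrightarrow> (\<integral>\<^sup>+x\<in>E. (\<Sum>j. c (k + j) x) \<partial>M) \<le> (\<integral>\<^sup>+x\<in>E. N x \<partial>M)"
  shows "(\<Sum>j. \<integral>\<^sup>+x. c j x * a j x \<partial>M) \<le> (\<integral>\<^sup>+x. N x * (SUP n. a n x) \<partial>M)"
proof -
  have [measurable]: "a n \<in> borel_measurable M" for n using a by (rule measurable_G_imp)
  \<comment> \<open>Layer cake density for exponent 1, left unsimplified to match
    \<open>nn_integral_layer_cake\<close>; it equals 1 for t > 0.\<close>
  let ?\<theta> = "\<lambda>t::real. indicator {0<..} t * ennreal (1 * t powr (1 - 1))"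
  let ?S = "\<lambda>j t. {x. ennreal t < a j x}"
  have [measurable]: "(\<lambda>t. \<integral>\<^sup>+x. c j x * indicator (?S j t) x \<partial>M) \<in> borel_measurable borel" for j
    by (rule borel_measurable_nn_integral_superlevel) measurable
  have level: "(\<Sum>j. \<integral>\<^sup>+x. c j x * indicator (?S j t) x \<partial>M)
      \<le> (\<integral>\<^sup>+x. N x * indicator {x. ennreal t < (SUP n. a n x)} x \<partial>M)" for t
  proof -
    have meas: "(\<lambda>x. c j x * indicator (?S j t) x) \<in> borel_measurable M" for j
    proof -
      have "(\<lambda>x. c j x * indicator (?S j t) x) = (\<lambda>x. c j x * (if ennreal t < a j x then 1 else 0))"
        by (auto split: split_indicator)
      then show ?thesis by simp
    qed
    have "(\<Sum>j. \<integral>\<^sup>+x. c j x * indicator (?S j t) x \<partial>M) = (\<integral>\<^sup>+x. (\<Sum>j. c j x * indicator (?S j t) x) \<partial>M)"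
      by (rule nn_integral_suminf[symmetric]) (rule meas)
    also have "\<dots> \<le> (\<Sum>k. \<integral>\<^sup>+x\<in>first_above a t k. (\<Sum>j. c (k + j) x) \<partial>M)"
    proof (rule nn_integral_stopping_le)
      fix x k assume k: "x \<in> first_above a t k"
      have "(\<Sum>j. c j x * indicator (?S j t) x) = (\<Sum>j. c (j + k) x * indicator (?S (j + k) t) x)
          + (\<Sum>j<k. c j x * indicator (?S j t) x)"
        by (rule suminf_offset) simp
      also have "(\<Sum>j<k. c j x * indicator (?S j t) x) = 0"
        using k by (intro sum.neutral) (auto simp: first_above_def)
      also have "(\<Sum>j. c (j + k) x * indicator (?S (j + k) t) x) \<le> (\<Sum>j. c (j + k) x)"
        by (intro suminf_le) (auto split: split_indicator)
      finally show "(\<Sum>j. c j x * indicator (?S j t) x) \<le> (\<Sum>j. c (k + j) x)"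
        by (simp add: add.commute)
    next
      fix x assume "\<not> ennreal t < (SUP n. a n x)"
      then have "indicator (?S j t) x = (0 :: ennreal)" for j by (auto simp: less_SUP_iff)
      then show "(\<Sum>j. c j x * indicator (?S j t) x) = 0" by simp
    qed (use a in auto)
    also have "\<dots> \<le> (\<Sum>k. \<integral>\<^sup>+x\<in>first_above a t k. N x \<partial>M)"
      by (intro suminf_le test first_above_sets a) auto
    also have "\<dots> = (\<integral>\<^sup>+x. N x * indicator {x. ennreal t < (SUP n. a n x)} x \<partial>M)"
      by (rule suminf_set_nn_integral_first_above) (use a in auto)
    finally show ?thesis .
  qed
  have "(\<Sum>j. \<integral>\<^sup>+x. c j x * a j x \<partial>M) = (\<Sum>j. \<integral>\<^sup>+t. ?\<theta> t * (\<integral>\<^sup>+x. c j x * indicator (?S j t) x \<partial>M) \<partial>lborel)"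
    using nn_integral_layer_cake[of "a _" "c _" 1] by simp
  also have "\<dots> = (\<integral>\<^sup>+t. (\<Sum>j. ?\<theta> t * (\<integral>\<^sup>+x. c j x * indicator (?S j t) x \<partial>M)) \<partial>lborel)"
    by (rule nn_integral_suminf[symmetric]) measurable
  also have "\<dots> \<le> (\<integral>\<^sup>+t. ?\<theta> t * (\<integral>\<^sup>+x. N x * indicator {x. ennreal t < (SUP n. a n x)} x \<partial>M) \<partial>lborel)"
    unfolding ennreal_suminf_cmult by (intro nn_integral_mono mult_left_mono level) simp
  also have "\<dots> = (\<integral>\<^sup>+x. N x * (SUP n. a n x) \<partial>M)"
    using nn_integral_layer_cake[of "\<lambda>x. SUP n. a n x" N 1] by simp
  finally show ?thesis .
qed

text \<open>On the event that time k is the first above t, the conditional expectation exceeds t and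
  has the same integral as f, since the event lies in \<open>G k\<close>. These bounds are summed
  over k.\<close>

lemma Doob_weak_type:
  assumes [measurable]: "f \<in> borel_measurable M"
  shows "t * emeasure M {x \<in> space M. t < (SUP n. nn_cond_exp M (G n) f x)} \<le> (\<integral>\<^sup>+x. f x \<partial>M)"
proof -
  let ?a = "\<lambda>n. nn_cond_exp M (G n) f"
  have a: "?a n \<in> borel_measurable (G n)" for n by measurable
  have [measurable]: "first_above ?a t k \<in> sets M" for k
    using first_above_sets[of ?a, OF a] by (rule sets_G_imp_sets)
  have "t * emeasure M {x \<in> space M. t < (SUP n. nn_cond_exp M (G n) f x)}
      = (\<Sum>k. t * emeasure M (first_above ?a t k))"
    unfolding UN_first_above[of ?a t, symmetric] ennreal_suminf_cmult
    by (subst suminf_emeasure) (auto intro: disjoint_first_above)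
  also have "\<dots> \<le> (\<Sum>k. \<integral>\<^sup>+x\<in>first_above ?a t k. f x \<partial>M)"
  proof (intro suminf_le)
    fix k
    have "t * emeasure M (first_above ?a t k) = (\<integral>\<^sup>+x\<in>first_above ?a t k. t \<partial>M)"
      by (simp add: nn_integral_cmult_indicator)
    also have "\<dots> \<le> (\<integral>\<^sup>+x\<in>first_above ?a t k. ?a k x \<partial>M)"
      by (intro nn_integral_mono) (auto simp: first_above_def split: split_indicator)
    also have "\<dots> = (\<integral>\<^sup>+x\<in>first_above ?a t k. f x \<partial>M)"
      by (intro set_nn_integral_cond_exp first_above_sets a) simp
    finally show "t * emeasure M (first_above ?a t k) \<le> (\<integral>\<^sup>+x\<in>first_above ?a t k. f x \<partial>M)" .
  qed auto
  also have "\<dots> = (\<integral>\<^sup>+x. f x * indicator {x. t < (SUP n. ?a n x)} x \<partial>M)"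
    by (rule suminf_set_nn_integral_first_above) (use a in auto)
  also have "\<dots> \<le> (\<integral>\<^sup>+x. f x \<partial>M)"
    by (intro nn_integral_mono) (auto split: split_indicator)
  finally show ?thesis .
qed

text \<open>Let g be the part of f exceeding t / 2. As f <= t / 2 + g, a conditional expectation of
  f above t forces that of g above t / 2; the weak-type bound at level t / 2 costs the factor
  2.\<close>

lemma Doob_truncated_weak_type:
  assumes [measurable]: "f \<in> borel_measurable M" and "0 < t"
  shows "ennreal t * emeasure M {x \<in> space M. ennreal t < (SUP n. nn_cond_exp M (G n) f x)}
    \<le> 2 * (\<integral>\<^sup>+x. f x * indicator {x. ennreal t < 2 * f x} x \<partial>M)"
proof -
  define g where "g x = f x * (if ennreal t < 2 * f x then 1 else 0)" for x
  have [measurable]: "g \<in> borel_measurable M" unfolding g_def by measurable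
  have half: "ennreal t = 2 * ennreal (t / 2)"
    using \<open>0 < t\<close> by (subst numeral_mult_ennreal) auto
  have split: "f x \<le> ennreal (t / 2) + g x" for x
  proof (cases "ennreal t < 2 * f x")
    case False
    then have "2 * f x \<le> 2 * ennreal (t / 2)" unfolding half by simp
    then have "f x \<le> ennreal (t / 2)" by (subst (asm) ennreal_mult_le_mult_iff) auto
    then show ?thesis by (simp add: g_def False)
  qed (simp add: g_def)
  have "AE x in M. \<forall>n. nn_cond_exp M (G n) f x \<le> ennreal (t / 2) + nn_cond_exp M (G n) g x"
  proof (intro AE_all_countable[THEN iffD2] allI)
    fix n
    interpret S: sigma_finite_subalgebra M "G n" by (rule subalg)
    have "AE x in M. nn_cond_exp M (G n) f x \<le> nn_cond_exp M (G n) (\<lambda>x. ennreal (t / 2) + g x) x"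
      using split by (intro S.nn_cond_exp_mono) auto
    moreover have "AE x in M. nn_cond_exp M (G n) (\<lambda>x. ennreal (t / 2)) x + nn_cond_exp M (G n) g x
        = nn_cond_exp M (G n) (\<lambda>x. ennreal (t / 2) + g x) x"
      by (rule S.nn_cond_exp_sum) auto
    moreover have "AE x in M. ennreal (t / 2) = nn_cond_exp M (G n) (\<lambda>x. ennreal (t / 2)) x"
      by (rule S.nn_cond_exp_F_meas) simp
    ultimately show "AE x in M. nn_cond_exp M (G n) f x \<le> ennreal (t / 2) + nn_cond_exp M (G n) g x"
      by eventually_elim auto
  qed
  then have "emeasure M {x \<in> space M. ennreal t < (SUP n. nn_cond_exp M (G n) f x)}
      \<le> emeasure M {x \<in> space M. ennreal (t / 2) < (SUP n. nn_cond_exp M (G n) g x)}"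
  proof (intro emeasure_mono_AE, elim AE_mp, intro AE_I2 impI)
    fix x
    assume elim: "\<forall>n. nn_cond_exp M (G n) f x \<le> ennreal (t / 2) + nn_cond_exp M (G n) g x"
      and x: "x \<in> {x \<in> space M. ennreal t < (SUP n. nn_cond_exp M (G n) f x)}"
    have tt: "ennreal t = ennreal (t / 2) + ennreal (t / 2)"
      using \<open>0 < t\<close> by (simp flip: ennreal_plus)
    have "\<exists>n. ennreal (t / 2) < nn_cond_exp M (G n) g x" if "ennreal t < nn_cond_exp M (G n) f x" for n
    proof -
      have "ennreal (t / 2) + ennreal (t / 2) < ennreal (t / 2) + nn_cond_exp M (G n) g x"
        using that spec[OF elim, of n] unfolding tt by (rule less_le_trans)
      then show ?thesis by (auto simp: ennreal_add_left_cancel_less)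
    qed
    then show "x \<in> {x \<in> space M. ennreal (t / 2) < (SUP n. nn_cond_exp M (G n) g x)}"
      using x by (auto simp: less_SUP_iff)
  qed measurable
  then have "ennreal t * emeasure M {x \<in> space M. ennreal t < (SUP n. nn_cond_exp M (G n) f x)}
      \<le> 2 * (ennreal (t / 2) * emeasure M {x \<in> space M. ennreal (t / 2) < (SUP n. nn_cond_exp M (G n) g x)})"
    unfolding half by (simp add: mult.assoc mult_left_mono)
  also have "\<dots> \<le> 2 * (\<integral>\<^sup>+x. g x \<partial>M)"
    by (intro mult_left_mono Doob_weak_type) auto
  also have "(\<integral>\<^sup>+x. g x \<partial>M) = (\<integral>\<^sup>+x. f x * indicator {x. ennreal t < 2 * f x} x \<partial>M)"
    by (intro nn_integral_cong) (auto simp: g_def split: split_indicator)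
  finally show ?thesis .
qed

text \<open>The truncated weak-type bound is inserted into the layer cake formula, which is then
  read backwards for 2 f with weight f and exponent e - 1. The truncation avoids dividing by a norm
  of the maximal function, which might be infinite.\<close>

lemma Doob_maximal:
  assumes [measurable]: "f \<in> borel_measurable M" and "1 < e"
  shows "(\<integral>\<^sup>+x. enn_powr (SUP n. nn_cond_exp M (G n) f x) e \<partial>M)
    \<le> ennreal (2 powr e * e / (e - 1)) * (\<integral>\<^sup>+x. enn_powr (f x) e \<partial>M)"
proof -
  let ?m = "\<lambda>x. SUP n. nn_cond_exp M (G n) f x"
  have "(\<integral>\<^sup>+x. enn_powr (?m x) e \<partial>M) = (\<integral>\<^sup>+t. indicator {0<..} t * ennreal (e * t powr (e - 1)) *
      (\<integral>\<^sup>+x. 1 * indicator {x. ennreal t < ?m x} x \<partial>M) \<partial>lborel)"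
    using nn_integral_layer_cake[of ?m "\<lambda>x. 1" e] \<open>1 < e\<close> by simp
  also have "\<dots> \<le> (\<integral>\<^sup>+t. ennreal (2 * e / (e - 1)) * (indicator {0<..} t * ennreal ((e - 1) * t powr (e - 1 - 1)) *
      (\<integral>\<^sup>+x. f x * indicator {x. ennreal t < 2 * f x} x \<partial>M)) \<partial>lborel)"
  proof (rule nn_integral_mono)
    fix t :: real
    let ?I = "\<integral>\<^sup>+x. f x * indicator {x. ennreal t < 2 * f x} x \<partial>M"
    show "indicator {0<..} t * ennreal (e * t powr (e - 1)) * (\<integral>\<^sup>+x. 1 * indicator {x. ennreal t < ?m x} x \<partial>M)
      \<le> ennreal (2 * e / (e - 1)) * (indicator {0<..} t * ennreal ((e - 1) * t powr (e - 1 - 1)) * ?I)"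
    proof (cases "0 < t")
      case True
      have "(\<integral>\<^sup>+x. 1 * indicator {x. ennreal t < ?m x} x \<partial>M)
          = (\<integral>\<^sup>+x. indicator {x \<in> space M. ennreal t < ?m x} x \<partial>M)"
        by (intro nn_integral_cong) (auto split: split_indicator)
      also have "\<dots> = emeasure M {x \<in> space M. ennreal t < ?m x}"
        by (rule nn_integral_indicator) measurable
      finally have eq: "(\<integral>\<^sup>+x. 1 * indicator {x. ennreal t < ?m x} x \<partial>M) = emeasure M {x \<in> space M. ennreal t < ?m x}" .
      have p: "e * t powr (e - 1) = e * t powr (e - 2) * t"
        using True powr_add[of t "e - 2" 1] by simp
      have "ennreal (e * t powr (e - 1)) * emeasure M {x \<in> space M. ennreal t < ?m x}
        = ennreal (e * t powr (e - 2)) * (ennreal t * emeasure M {x \<in> space M. ennreal t < ?m x})"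
        unfolding p using True \<open>1 < e\<close> by (subst ennreal_mult) (auto simp: mult.assoc)
      also have "\<dots> \<le> ennreal (e * t powr (e - 2)) * (2 * ?I)"
        using True by (intro mult_left_mono Doob_truncated_weak_type) auto
      also have "\<dots> = ennreal (2 * e * t powr (e - 2)) * ?I"
        using \<open>1 < e\<close> by (simp add: mult_ac ennreal_mult)
      \<comment> \<open>The layer cake density for e - 1 is split off; the factor e / (e - 1)
        originates here.\<close>
      also have "2 * e * t powr (e - 2) = (2 * e / (e - 1)) * ((e - 1) * t powr (e - 1 - 1))"
        using \<open>1 < e\<close> by (simp add: field_simps)
      also have "ennreal \<dots> * ?I = ennreal (2 * e / (e - 1)) * (ennreal ((e - 1) * t powr (e - 1 - 1)) * ?I)"
        using \<open>1 < e\<close> by (subst ennreal_mult) (auto simp: mult.assoc)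
      finally show ?thesis unfolding eq using True by simp
    qed simp
  qed
  also have "\<dots> = ennreal (2 * e / (e - 1)) * (\<integral>\<^sup>+t. indicator {0<..} t * ennreal ((e - 1) * t powr (e - 1 - 1)) *
      (\<integral>\<^sup>+x. f x * indicator {x. ennreal t < 2 * f x} x \<partial>M) \<partial>lborel)"
    by (intro nn_integral_cmult borel_measurable_times_ennreal, simp, simp)
       (simp add: borel_measurable_nn_integral_superlevel)
  also have "\<dots> = ennreal (2 * e / (e - 1)) * (\<integral>\<^sup>+x. f x * enn_powr (2 * f x) (e - 1) \<partial>M)"
    using nn_integral_layer_cake[of "\<lambda>x. 2 * f x" f "e - 1"] \<open>1 < e\<close> by simp
  also have "(\<lambda>x. f x * enn_powr (2 * f x) (e - 1)) = (\<lambda>x. ennreal (2 powr (e - 1)) * enn_powr (f x) e)"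
    using enn_powr_add[of _ 1 "e - 1"] enn_powr_ennreal[of 2 "e - 1"]
    by (simp add: enn_powr_mult fun_eq_iff mult_ac)
  also have "(\<integral>\<^sup>+x. ennreal (2 powr (e - 1)) * enn_powr (f x) e \<partial>M) = ennreal (2 powr (e - 1)) * (\<integral>\<^sup>+x. enn_powr (f x) e \<partial>M)"
    by (rule nn_integral_cmult) measurable
  also have "ennreal (2 * e / (e - 1)) * (ennreal (2 powr (e - 1)) * (\<integral>\<^sup>+x. enn_powr (f x) e \<partial>M))
    = ennreal (2 powr e * e / (e - 1)) * (\<integral>\<^sup>+x. enn_powr (f x) e \<partial>M)"
  proof -
    have "2 * e / (e - 1) * 2 powr (e - 1) = 2 powr e * e / (e - 1)"
      using \<open>1 < e\<close> by (simp add: powr_diff field_simps)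
    then have "ennreal (2 * e / (e - 1)) * ennreal (2 powr (e - 1)) = ennreal (2 powr e * e / (e - 1))"
      using \<open>1 < e\<close> by (subst ennreal_mult[symmetric]) auto
    then show ?thesis by (simp flip: mult.assoc)
  qed
  finally show ?thesis .
qed

text \<open>A Carleson embedding for suprema, tested against the power u of a second measure.
  Superadditivity sums the tests over the stopping events and gives the measure of the level set to
  the power u; Chebyshev's inequality trades the surplus u - 1 for a power of the full
  integral.\<close>

lemma nn_integral_maximal_Carleson:
  assumes a: "\<And>n. a n \<in> borel_measurable (G n)"
    and [measurable]: "\<And>n. b n \<in> borel_measurable M"
    and \<nu>: "sigma_finite_measure \<nu>" and sets_\<nu> [measurable_cong]: "sets \<nu> = sets M"
    and r: "0 < r" and u: "1 \<le> u"
    and test: "\<And>k E. E \<in> sets (G k) \<Longrightarrow>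
      (\<integral>\<^sup>+x\<in>E. (SUP j. b (k + j) x) \<partial>M) \<le> A * enn_powr (emeasure \<nu> E) u"
  shows "(\<integral>\<^sup>+x. (SUP j. b j x * enn_powr (a j x) (r * u)) \<partial>M)
    \<le> A * ennreal u * enn_powr (\<integral>\<^sup>+x. enn_powr (SUP n. a n x) r \<partial>\<nu>) u"
proof -
  interpret \<nu>: sigma_finite_measure \<nu> by fact
  interpret pair_sigma_finite M lborel
    by (rule pair_sigma_finite.intro) (rule sigma_finite_measure_axioms, rule lborel.sigma_finite_measure_axioms)
  have space_\<nu>: "space \<nu> = space M" using sets_\<nu> by (rule sets_eq_imp_space_eq)
  have [measurable]: "a n \<in> borel_measurable M" for n using a by (rule measurable_G_imp)
  define X where "X = (\<integral>\<^sup>+x. enn_powr (SUP n. a n x) r \<partial>\<nu>)"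
  define \<Phi> where "\<Phi> t x = (SUP j. b j x * (if ennreal t < a j x then 1 else 0))" for t x
  define \<phi> where "\<phi> t = emeasure \<nu> {x \<in> space M. ennreal t < (SUP n. a n x)}" for t
  let ?\<theta> = "\<lambda>e t::real. indicator {0<..} t * ennreal (e * t powr (e - 1))"
  have s: "0 < r * u" using r u by simp
  have [measurable]: "(\<lambda>(x, t). \<Phi> t x) \<in> borel_measurable (M \<Otimes>\<^sub>M lborel)"
    unfolding \<Phi>_def by measurable
  have level: "(\<integral>\<^sup>+x. \<Phi> t x \<partial>M) \<le> A * enn_powr (\<phi> t) u" for t
  proof -
    have "(\<integral>\<^sup>+x. \<Phi> t x \<partial>M) \<le> (\<Sum>k. \<integral>\<^sup>+x\<in>first_above a t k. (SUP j. b (k + j) x) \<partial>M)"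
    proof (rule nn_integral_stopping_le)
      fix x k assume k: "x \<in> first_above a t k"
      show "\<Phi> t x \<le> (SUP j. b (k + j) x)"
        unfolding \<Phi>_def
      proof (rule SUP_least)
        fix j
        show "b j x * (if ennreal t < a j x then 1 else 0) \<le> (SUP j. b (k + j) x)"
        proof (cases "k \<le> j")
          case True
          then show ?thesis by (auto intro!: SUP_upper2[of "j - k"])
        qed (use k in \<open>auto simp: first_above_def\<close>)
      qed
    next
      fix x assume "\<not> ennreal t < (SUP n. a n x)"
      then have "\<not> ennreal t < a j x" for j by (auto simp: less_SUP_iff)
      then show "\<Phi> t x = 0" unfolding \<Phi>_def by simp
    qed (use a in auto)
    also have "\<dots> \<le> (\<Sum>k. A * enn_powr (emeasure \<nu> (first_above a t k)) u)"
      by (intro suminf_le test first_above_sets a) auto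
    also have "\<dots> \<le> A * enn_powr (\<Sum>k. emeasure \<nu> (first_above a t k)) u"
      using enn_powr_suminf_superadditive[OF u] by (simp add: mult_left_mono)
    also have "(\<Sum>k. emeasure \<nu> (first_above a t k)) = \<phi> t"
      unfolding \<phi>_def UN_first_above[symmetric]
      by (rule suminf_emeasure) (use sets_G_imp_sets[OF first_above_sets[OF a]] sets_\<nu> disjoint_first_above in auto)
    finally show ?thesis .
  qed
  have \<phi>_eq: "(\<integral>\<^sup>+x. 1 * indicator {x. ennreal t < (SUP n. a n x)} x \<partial>\<nu>) = \<phi> t" for t
  proof -
    have "(\<integral>\<^sup>+x. 1 * indicator {x. ennreal t < (SUP n. a n x)} x \<partial>\<nu>)
      = (\<integral>\<^sup>+x. indicator {x \<in> space M. ennreal t < (SUP n. a n x)} x \<partial>\<nu>)"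
      by (intro nn_integral_cong) (auto simp: space_\<nu> split: split_indicator)
    also have "\<dots> = \<phi> t"
      unfolding \<phi>_def by (rule nn_integral_indicator) measurable
    finally show ?thesis .
  qed
  have X: "X = (\<integral>\<^sup>+t. ?\<theta> r t * \<phi> t \<partial>lborel)"
    unfolding X_def using \<nu>.nn_integral_layer_cake[of "\<lambda>x. SUP n. a n x" "\<lambda>x. 1" r] r by (simp flip: \<phi>_eq)
  have [measurable]: "\<phi> \<in> borel_measurable borel"
    unfolding \<phi>_eq[symmetric] by (rule \<nu>.borel_measurable_nn_integral_superlevel) measurable
  have Chebyshev: "ennreal (t powr r) * \<phi> t \<le> X" if "0 < t" for t
  proof -
    have "ennreal (t powr r) * \<phi> t = (\<integral>\<^sup>+x. ennreal (t powr r) * indicator {x \<in> space M. ennreal t < (SUP n. a n x)} x \<partial>\<nu>)"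
      unfolding \<phi>_def by (rule nn_integral_cmult_indicator[symmetric]) measurable
    also have "\<dots> \<le> X"
      unfolding X_def using enn_powr_mono[of r "ennreal t"] that r
      by (intro nn_integral_mono) (auto simp: enn_powr_ennreal split: split_indicator)
    finally show ?thesis .
  qed
  have "(\<integral>\<^sup>+x. (SUP j. b j x * enn_powr (a j x) (r * u)) \<partial>M) \<le> (\<integral>\<^sup>+x. (\<integral>\<^sup>+t. ?\<theta> (r * u) t * \<Phi> t x \<partial>lborel) \<partial>M)"
  \<comment> \<open>Layer cake is an equality for each j, and \<open>\<Phi> t x\<close> dominates
    every integrand, so the supremum of the integrals is at most the integral of the
    supremum.\<close>
  proof (intro nn_integral_mono SUP_least)
    fix x j
    have "b j x * enn_powr (a j x) (r * u) = b j x * (\<integral>\<^sup>+t. indicator {0<..} t * indicator {t. ennreal t < a j x} t *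
        ennreal (r * u * t powr (r * u - 1)) \<partial>lborel)"
      using nn_integral_power_layer[OF s, of "a j x"] by simp
    also have "\<dots> = (\<integral>\<^sup>+t. b j x * (indicator {0<..} t * indicator {t. ennreal t < a j x} t *
        ennreal (r * u * t powr (r * u - 1))) \<partial>lborel)"
      by (rule nn_integral_cmult[symmetric]) measurable
    also have "\<dots> \<le> (\<integral>\<^sup>+t. ?\<theta> (r * u) t * \<Phi> t x \<partial>lborel)"
    proof (rule nn_integral_mono)
      fix t
      have "b j x * indicator {t. ennreal t < a j x} t \<le> \<Phi> t x"
        unfolding \<Phi>_def by (rule SUP_upper2[of j]) auto
      then have "?\<theta> (r * u) t * (b j x * indicator {t. ennreal t < a j x} t) \<le> ?\<theta> (r * u) t * \<Phi> t x"
        by (rule mult_left_mono) simp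
      then show "b j x * (indicator {0<..} t * indicator {t. ennreal t < a j x} t * ennreal (r * u * t powr (r * u - 1)))
          \<le> ?\<theta> (r * u) t * \<Phi> t x"
        by (simp add: mult_ac)
    qed
    finally show "b j x * enn_powr (a j x) (r * u) \<le> (\<integral>\<^sup>+t. ?\<theta> (r * u) t * \<Phi> t x \<partial>lborel)" .
  qed
  also have "\<dots> = (\<integral>\<^sup>+t. (\<integral>\<^sup>+x. ?\<theta> (r * u) t * \<Phi> t x \<partial>M) \<partial>lborel)"
    by (rule Fubini'[symmetric]) measurable
  also have "\<dots> \<le> (\<integral>\<^sup>+t. (A * ennreal u * enn_powr X (u - 1)) * (?\<theta> r t * \<phi> t) \<partial>lborel)"
  proof (rule nn_integral_mono)
    fix t :: real
    have "(\<integral>\<^sup>+x. ?\<theta> (r * u) t * \<Phi> t x \<partial>M) = ?\<theta> (r * u) t * (\<integral>\<^sup>+x. \<Phi> t x \<partial>M)"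
      by (rule nn_integral_cmult) (simp add: \<Phi>_def)
    also have "\<dots> \<le> (A * ennreal u * enn_powr X (u - 1)) * (?\<theta> r t * \<phi> t)"
    proof (cases "0 < t")
      case True
      \<comment> \<open>From r u - 1 = (r - 1) + r (u - 1): the surplus is the power u - 1 of
        \<open>t powr r\<close>, which joins the surplus of \<open>\<phi> t\<close> so that
        Chebyshev applies to the product.\<close>
      have "t powr (r * u - 1) = t powr (r - 1) * (t powr r) powr (u - 1)"
        using True by (simp add: powr_powr algebra_simps flip: powr_add)
      then have pw: "ennreal (r * u * t powr (r * u - 1)) = ennreal u * ennreal (r * t powr (r - 1)) * enn_powr (ennreal (t powr r)) (u - 1)"
        using r u by (simp add: enn_powr_ennreal mult_ac flip: ennreal_mult)
      have "ennreal (r * u * t powr (r * u - 1)) * (\<integral>\<^sup>+x. \<Phi> t x \<partial>M)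
          \<le> ennreal (r * u * t powr (r * u - 1)) * (A * enn_powr (\<phi> t) u)"
        by (intro mult_left_mono level) simp
      also have "enn_powr (\<phi> t) u = \<phi> t * enn_powr (\<phi> t) (u - 1)"
        using enn_powr_add[of "\<phi> t" 1 "u - 1"] by simp
      also have "ennreal (r * u * t powr (r * u - 1)) * (A * (\<phi> t * enn_powr (\<phi> t) (u - 1)))
          = A * ennreal u * enn_powr (ennreal (t powr r) * \<phi> t) (u - 1) * (ennreal (r * t powr (r - 1)) * \<phi> t)"
        unfolding pw enn_powr_mult by (simp add: mult_ac)
      also have "\<dots> \<le> A * ennreal u * enn_powr X (u - 1) * (ennreal (r * t powr (r - 1)) * \<phi> t)"
        using Chebyshev[OF True] u by (intro mult_right_mono mult_left_mono enn_powr_mono) auto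
      finally show ?thesis using True by simp
    qed simp
    finally show "(\<integral>\<^sup>+x. ?\<theta> (r * u) t * \<Phi> t x \<partial>M) \<le> \<dots>" .
  qed
  also have "\<dots> = (A * ennreal u * enn_powr X (u - 1)) * X"
    unfolding X by (rule nn_integral_cmult) measurable
  also have "\<dots> = A * ennreal u * enn_powr X u"
    using enn_powr_add[of X 1 "u - 1"] by (simp add: mult_ac)
  finally show ?thesis unfolding X_def .
qed

end

section \<open>The bilinear bound from the testing condition\<close>

context nat_filtration
begin

text \<open>The Bayes formula for a change of measure. Over a set of \<open>G n\<close>, the
  conditional expectation of w may be replaced by w, because the other factor is measurable for
  \<open>G n\<close>; what remains is an integral for the measure with density w.\<close>

lemma nn_cond_exp_weighted:
  assumes [measurable]: "w \<in> borel_measurable M" "g \<in> borel_measurable M"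
    and \<nu>: "nat_filtration (density M w) G"
  shows "AE x in M. nn_cond_exp M (G n) (\<lambda>x. w x * g x) x
    = nn_cond_exp M (G n) w x * nn_cond_exp (density M w) (G n) g x"
proof -
  interpret S: sigma_finite_subalgebra M "G n" by (rule subalg)
  interpret \<nu>: nat_filtration "density M w" G by fact
  let ?h = "nn_cond_exp (density M w) (G n) g"
  have [measurable]: "?h \<in> borel_measurable (G n)" by (rule borel_measurable_nn_cond_exp)
  then have [measurable]: "?h \<in> borel_measurable M" by (rule measurable_G_imp)
  have "AE x in M. nn_cond_exp M (G n) w x * ?h x = nn_cond_exp M (G n) (\<lambda>x. w x * g x) x"
  proof (rule S.nn_cond_exp_charact)
    fix E assume E [measurable]: "E \<in> sets (G n)"
    then have [measurable]: "E \<in> sets M" by (rule sets_G_imp_sets)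
    have "(\<integral>\<^sup>+x\<in>E. w x * g x \<partial>M) = (\<integral>\<^sup>+x\<in>E. g x \<partial>density M w)"
      by (subst nn_integral_density) (auto simp: mult_ac)
    also have "\<dots> = (\<integral>\<^sup>+x\<in>E. ?h x \<partial>density M w)"
      by (rule \<nu>.set_nn_integral_cond_exp[symmetric]) (auto simp: E)
    also have "\<dots> = (\<integral>\<^sup>+x. (?h x * indicator E x) * w x \<partial>M)"
      by (subst nn_integral_density) (auto simp: mult_ac)
    also have "\<dots> = (\<integral>\<^sup>+x. (?h x * indicator E x) * nn_cond_exp M (G n) w x \<partial>M)"
      by (rule S.nn_cond_exp_intg[symmetric]) measurable
    finally show "(\<integral>\<^sup>+x\<in>E. w x * g x \<partial>M) = (\<integral>\<^sup>+x\<in>E. nn_cond_exp M (G n) w x * ?h x \<partial>M)"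
      by (simp add: mult_ac)
  qed measurable
  then show ?thesis by eventually_elim simp
qed

section \<open>Tails of the coefficients and of the operator\<close>

definition tail_sum :: "(nat \<Rightarrow> 'a \<Rightarrow> ennreal) \<Rightarrow> nat \<Rightarrow> 'a \<Rightarrow> ennreal" where
  "tail_sum \<alpha> n x = (\<Sum>k. \<alpha> (n + k) x)"

definition tail_op :: "(nat \<Rightarrow> 'a \<Rightarrow> ennreal) \<Rightarrow> nat \<Rightarrow> ('a \<Rightarrow> ennreal) \<Rightarrow> 'a \<Rightarrow> ennreal" where
  "tail_op \<alpha> n h x = (\<Sum>k. \<alpha> (n + k) x * nn_cond_exp M (G (n + k)) h x)"

end

text \<open>The two halves of the comparability serve opposite ends: \<open>tail_le\<close> bounds
  tails of the operator from above, \<open>le_tail\<close> bounds \<open>\<beta>\<close> times a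
  conditional expectation by such tails.\<close>

locale nat_filtration_coeff = nat_filtration +
  fixes \<alpha> :: "nat \<Rightarrow> 'a \<Rightarrow> ennreal" and c :: ennreal
  assumes \<alpha>_meas: "\<And>n. \<alpha> n \<in> borel_measurable (G n)"
    and tail_le: "\<And>n. AE x in M. tail_sum \<alpha> n x \<le> c * nn_cond_exp M (G n) (tail_sum \<alpha> n) x"
    and le_tail: "\<And>n. AE x in M. nn_cond_exp M (G n) (tail_sum \<alpha> n) x \<le> c * tail_sum \<alpha> n x"
begin

abbreviation \<beta> where "\<beta> n \<equiv> nn_cond_exp M (G n) (tail_sum \<alpha> n)"

lemma \<alpha>_meas_M [measurable]: "\<alpha> n \<in> borel_measurable M"
  using \<alpha>_meas by (rule measurable_G_imp)

lemma tail_sum_meas [measurable]: "tail_sum \<alpha> n \<in> borel_measurable M"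
  unfolding tail_sum_def by measurable

lemma tail_op_meas [measurable]: "tail_op \<alpha> n h \<in> borel_measurable M"
  unfolding tail_op_def by measurable

lemma set_nn_integral_tail_op:
  assumes E: "E \<in> sets (G n)" and [measurable]: "h \<in> borel_measurable M"
  shows "(\<integral>\<^sup>+x\<in>E. tail_op \<alpha> n h x \<partial>M) = (\<integral>\<^sup>+x\<in>E. tail_sum \<alpha> n x * h x \<partial>M)"
proof -
  have [measurable]: "E \<in> sets M" using E by (rule sets_G_imp_sets)
  have "(\<integral>\<^sup>+x. indicator E x * \<alpha> (n + k) x * nn_cond_exp M (G (n + k)) h x \<partial>M)
      = (\<integral>\<^sup>+x. indicator E x * \<alpha> (n + k) x * h x \<partial>M)" for k
  proof (rule sigma_finite_subalgebra.nn_cond_exp_intg[OF subalg])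
    have [measurable]: "E \<in> sets (G (n + k))" using E sets_mono[of n "n + k"] by auto
    show "(\<lambda>x. indicator E x * \<alpha> (n + k) x) \<in> borel_measurable (G (n + k))"
      using \<alpha>_meas[of "n + k"] by measurable
  qed measurable
  then have "(\<Sum>k. \<integral>\<^sup>+x. indicator E x * \<alpha> (n + k) x * nn_cond_exp M (G (n + k)) h x \<partial>M)
      = (\<Sum>k. \<integral>\<^sup>+x. indicator E x * \<alpha> (n + k) x * h x \<partial>M)" by simp
  then have "(\<integral>\<^sup>+x. (\<Sum>k. indicator E x * \<alpha> (n + k) x * nn_cond_exp M (G (n + k)) h x) \<partial>M)
      = (\<integral>\<^sup>+x. (\<Sum>k. indicator E x * \<alpha> (n + k) x * h x) \<partial>M)"
    by (subst (1 2) nn_integral_suminf) measurable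
  moreover have "(\<Sum>k. indicator E x * \<alpha> (n + k) x * nn_cond_exp M (G (n + k)) h x) = tail_op \<alpha> n h x * indicator E x"
      "(\<Sum>k. indicator E x * \<alpha> (n + k) x * h x) = tail_sum \<alpha> n x * h x * indicator E x" for x
    by (auto simp: tail_op_def tail_sum_def split: split_indicator)
  ultimately show ?thesis by simp
qed

text \<open>The tail sum need not be measurable for \<open>G n\<close>, but its majorant
  \<open>c * \<beta> n\<close> is; after this replacement h can be exchanged for its conditional
  expectation.\<close>

lemma set_nn_integral_tail_op_le:
  assumes E: "E \<in> sets (G n)" and [measurable]: "h \<in> borel_measurable M"
  shows "(\<integral>\<^sup>+x\<in>E. tail_op \<alpha> n h x \<partial>M) \<le> (\<integral>\<^sup>+x\<in>E. c * (\<beta> n x * nn_cond_exp M (G n) h x) \<partial>M)"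
proof -
  have [measurable]: "E \<in> sets M" using E by (rule sets_G_imp_sets)
  have "(\<integral>\<^sup>+x\<in>E. tail_op \<alpha> n h x \<partial>M) = (\<integral>\<^sup>+x\<in>E. tail_sum \<alpha> n x * h x \<partial>M)"
    by (rule set_nn_integral_tail_op) fact+
  also have "\<dots> \<le> (\<integral>\<^sup>+x. c * \<beta> n x * indicator E x * h x \<partial>M)"
  proof (rule nn_integral_mono_AE)
    show "AE x in M. tail_sum \<alpha> n x * h x * indicator E x \<le> c * \<beta> n x * indicator E x * h x"
      using tail_le[of n] by eventually_elim (auto intro: mult_right_mono split: split_indicator)
  qed
  also have "\<dots> = (\<integral>\<^sup>+x. c * \<beta> n x * indicator E x * nn_cond_exp M (G n) h x \<partial>M)"
  proof (rule sigma_finite_subalgebra.nn_cond_exp_intg[OF subalg, symmetric])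
    note E [measurable]
    show "(\<lambda>x. c * \<beta> n x * indicator E x) \<in> borel_measurable (G n)" by measurable
  qed fact
  finally show ?thesis by (simp add: mult_ac)
qed

text \<open>\<open>\<beta> n\<close> is moved inside the conditional expectation and bounded by c
  times the tail sum, whose product with h has the same conditional expectation as
  \<open>tail_op \<alpha> n h\<close>.\<close>

lemma \<beta>_cond_exp_le:
  assumes [measurable]: "h \<in> borel_measurable M"
  shows "AE x in M. \<beta> n x * nn_cond_exp M (G n) h x \<le> c * nn_cond_exp M (G n) (tail_op \<alpha> n h) x"
proof -
  interpret S: sigma_finite_subalgebra M "G n" by (rule subalg)
  have 1: "AE x in M. \<beta> n x * nn_cond_exp M (G n) h x = nn_cond_exp M (G n) (\<lambda>x. \<beta> n x * h x) x"
    by (rule S.nn_cond_exp_prod) measurable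
  have 2: "AE x in M. nn_cond_exp M (G n) (\<lambda>x. \<beta> n x * h x) x
      \<le> nn_cond_exp M (G n) (\<lambda>x. c * (tail_sum \<alpha> n x * h x)) x"
  proof (rule S.nn_cond_exp_mono)
    show "AE x in M. \<beta> n x * h x \<le> c * (tail_sum \<alpha> n x * h x)"
      using le_tail[of n] by eventually_elim (simp add: mult_right_mono flip: mult.assoc)
  qed measurable
  have 3: "AE x in M. c * nn_cond_exp M (G n) (\<lambda>x. tail_sum \<alpha> n x * h x) x
      = nn_cond_exp M (G n) (\<lambda>x. c * (tail_sum \<alpha> n x * h x)) x"
    by (rule S.nn_cond_exp_prod) measurable
  have 4: "AE x in M. nn_cond_exp M (G n) (tail_op \<alpha> n h) x = nn_cond_exp M (G n) (\<lambda>x. tail_sum \<alpha> n x * h x) x"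
  proof (rule S.nn_cond_exp_charact)
    fix E assume E: "E \<in> sets (G n)"
    then show "(\<integral>\<^sup>+x\<in>E. tail_sum \<alpha> n x * h x \<partial>M) = (\<integral>\<^sup>+x\<in>E. nn_cond_exp M (G n) (tail_op \<alpha> n h) x \<partial>M)"
      by (simp add: set_nn_integral_cond_exp set_nn_integral_tail_op)
  qed measurable
  from 1 2 3 4 show ?thesis by eventually_elim simp
qed

text \<open>Tails decrease in their starting time and E lies in every \<open>G (k + j)\<close>. So
  on E all terms are at most c times conditional expectations of the single function H, the tail
  from k cut off to E, and Doob's inequality applies to H.\<close>

lemma set_nn_integral_maximal_tail_le:
  assumes E: "E \<in> sets (G k)" and [measurable]: "h \<in> borel_measurable M" and "1 < s"
  shows "(\<integral>\<^sup>+x\<in>E. (SUP j. enn_powr (\<beta> (k + j) x * nn_cond_exp M (G (k + j)) h x) s) \<partial>M)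
    \<le> enn_powr c s * ennreal (2 powr s * s / (s - 1)) * (\<integral>\<^sup>+x\<in>E. enn_powr (tail_op \<alpha> k h x) s \<partial>M)"
proof -
  have [measurable]: "E \<in> sets M" using E by (rule sets_G_imp_sets)
  define H where "H = (\<lambda>x. indicator E x * tail_op \<alpha> k h x)"
  have [measurable]: "H \<in> borel_measurable M" unfolding H_def by measurable
  have "AE x in M. \<forall>j. indicator E x * (\<beta> (k + j) x * nn_cond_exp M (G (k + j)) h x)
      \<le> c * nn_cond_exp M (G (k + j)) H x"
  proof (intro AE_all_countable[THEN iffD2] allI)
    fix j
    interpret S: sigma_finite_subalgebra M "G (k + j)" by (rule subalg)
    have "tail_op \<alpha> (k + j) h x \<le> tail_op \<alpha> k h x" for x
      unfolding tail_op_def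
      by (subst (2) suminf_offset[where i = j]) (auto simp: add_ac)
    then have "AE x in M. nn_cond_exp M (G (k + j)) (tail_op \<alpha> (k + j) h) x
        \<le> nn_cond_exp M (G (k + j)) (tail_op \<alpha> k h) x"
      by (intro S.nn_cond_exp_mono) auto
    moreover have "AE x in M. indicator E x * nn_cond_exp M (G (k + j)) (tail_op \<alpha> k h) x
        = nn_cond_exp M (G (k + j)) H x"
      unfolding H_def using E sets_mono[of k "k + j"]
      by (intro S.nn_cond_exp_prod) auto
    ultimately show "AE x in M. indicator E x * (\<beta> (k + j) x * nn_cond_exp M (G (k + j)) h x)
        \<le> c * nn_cond_exp M (G (k + j)) H x"
      using \<beta>_cond_exp_le[OF \<open>h \<in> borel_measurable M\<close>, of "k + j"]
    proof eventually_elim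
      case (elim x)
      show ?case
      proof (cases "x \<in> E")
        case True
        have "\<beta> (k + j) x * nn_cond_exp M (G (k + j)) h x \<le> c * nn_cond_exp M (G (k + j)) (tail_op \<alpha> (k + j) h) x"
          using elim by simp
        also have "\<dots> \<le> c * nn_cond_exp M (G (k + j)) (tail_op \<alpha> k h) x"
          using elim by (intro mult_left_mono) auto
        also have "\<dots> = c * nn_cond_exp M (G (k + j)) H x"
          using elim True by simp
        finally show ?thesis using True by simp
      qed simp
    qed
  qed
  then have "AE x in M. (SUP j. enn_powr (\<beta> (k + j) x * nn_cond_exp M (G (k + j)) h x) s) * indicator E x
      \<le> enn_powr c s * enn_powr (SUP n. nn_cond_exp M (G n) H x) s"
  proof eventually_elim
    case (elim x)
    show ?case
    proof (cases "x \<in> E")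
      case True
      have "enn_powr (\<beta> (k + j) x * nn_cond_exp M (G (k + j)) h x) s
          \<le> enn_powr c s * enn_powr (SUP n. nn_cond_exp M (G n) H x) s" for j
      proof -
        have "\<beta> (k + j) x * nn_cond_exp M (G (k + j)) h x \<le> c * nn_cond_exp M (G (k + j)) H x"
          using spec[OF elim, of j] True by simp
        also have "\<dots> \<le> c * (SUP n. nn_cond_exp M (G n) H x)"
          by (intro mult_left_mono SUP_upper) auto
        finally show ?thesis
          unfolding enn_powr_mult[symmetric] using \<open>1 < s\<close> by (intro enn_powr_mono) auto
      qed
      then show ?thesis using True by (simp add: SUP_le_iff)
    qed simp
  qed
  then have "(\<integral>\<^sup>+x\<in>E. (SUP j. enn_powr (\<beta> (k + j) x * nn_cond_exp M (G (k + j)) h x) s) \<partial>M)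
      \<le> (\<integral>\<^sup>+x. enn_powr c s * enn_powr (SUP n. nn_cond_exp M (G n) H x) s \<partial>M)"
    by (rule nn_integral_mono_AE)
  also have "\<dots> = enn_powr c s * (\<integral>\<^sup>+x. enn_powr (SUP n. nn_cond_exp M (G n) H x) s \<partial>M)"
    by (rule nn_integral_cmult) measurable
  also have "\<dots> \<le> enn_powr c s * (ennreal (2 powr s * s / (s - 1)) * (\<integral>\<^sup>+x. enn_powr (H x) s \<partial>M))"
    by (intro mult_left_mono Doob_maximal) (use \<open>1 < s\<close> in auto)
  also have "(\<integral>\<^sup>+x. enn_powr (H x) s \<partial>M) = (\<integral>\<^sup>+x\<in>E. enn_powr (tail_op \<alpha> k h x) s \<partial>M)"
    by (intro nn_integral_cong) (auto simp: H_def split: split_indicator)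
  finally show ?thesis by (simp add: mult_ac)
qed

text \<open>The accumulated losses: the outer c from the first embedding, the root from the bound on
  N (c, Doob for s, the factor u, Doob for r), and Doob for p. Only c and the exponents
  enter.\<close>

definition bilinear_const :: "real \<Rightarrow> real \<Rightarrow> real \<Rightarrow> real \<Rightarrow> ennreal" where
  "bilinear_const p r s u = c
     * enn_powr (enn_powr c s * ennreal (2 powr s * s / (s - 1)) * ennreal u
         * enn_powr (ennreal (2 powr r * r / (r - 1))) u) (1 / s)
     * enn_powr (ennreal (2 powr p * p / (p - 1))) (1 / p)"

text \<open>Intended values are r = q', u = p' / q' and, for A, the power p' of the testing
  constant. The Carleson embedding produces the product of N and the maximal function of f, which
  Hoelder's inequality separates.\<close>

lemma bilinear_bound:
  assumes [measurable]: "w \<in> borel_measurable M" "f \<in> borel_measurable M" "g \<in> borel_measurable M"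
    and \<nu>: "nat_filtration (density M w) G"
    and p: "1 < p" and s: "s = conj_exp p" and r: "1 < r" and u: "1 \<le> u" and ru: "s = r * u"
    and test: "\<And>k E. E \<in> sets (G k) \<Longrightarrow>
      (\<integral>\<^sup>+x\<in>E. enn_powr (tail_op \<alpha> k w x) s \<partial>M) \<le> A * enn_powr (emeasure (density M w) E) u"
  shows "(\<integral>\<^sup>+x. tail_op \<alpha> 0 f x * (w x * g x) \<partial>M)
    \<le> bilinear_const p r s u * enn_powr A (1 / s)
       * enn_powr (\<integral>\<^sup>+x. enn_powr (f x) p \<partial>M) (1 / p)
       * enn_powr (\<integral>\<^sup>+x. enn_powr (g x) r \<partial>density M w) (1 / r)"
proof -
  interpret \<nu>: nat_filtration "density M w" G by fact
  define h where "h = (\<lambda>x. w x * g x)"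
  have [measurable]: "h \<in> borel_measurable M" unfolding h_def by measurable
  have s1: "1 < s" "1 / s + 1 / p = 1" using p by (auto simp: s conj_exp_def field_simps)
  let ?E = "\<lambda>n. nn_cond_exp M (G n)" and ?E\<nu> = "\<lambda>n. nn_cond_exp (density M w) (G n)"
  let ?D = "\<lambda>e. ennreal (2 powr e * e / (e - 1))"
  define N where "N = (\<lambda>x. SUP n. \<beta> n x * ?E n h x)"
  have [measurable]: "N \<in> borel_measurable M" unfolding N_def by measurable
  have [measurable]: "?E\<nu> n g \<in> borel_measurable M" for n
    by (rule measurable_G_imp) (rule borel_measurable_nn_cond_exp)

  \<comment> \<open>The Bayes formula factors each term of N: the part with w is tested by the
    preceding maximal estimate, and the conditional expectations of g are handled by Doob's
    inequality for the weighted measure.\<close>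
  have N_bound: "(\<integral>\<^sup>+x. enn_powr (N x) s \<partial>M) \<le> enn_powr c s * ?D s * A * ennreal u
      * enn_powr (?D r * (\<integral>\<^sup>+x. enn_powr (g x) r \<partial>density M w)) u"
  proof -
    have "AE x in M. \<forall>n. ?E n h x = ?E n w x * ?E\<nu> n g x"
      unfolding h_def by (intro AE_all_countable[THEN iffD2] allI nn_cond_exp_weighted \<nu>) measurable
    then have "AE x in M. enn_powr (N x) s = (SUP n. enn_powr (\<beta> n x * ?E n w x) s * enn_powr (?E\<nu> n g x) (r * u))"
    proof eventually_elim
      case (elim x)
      have "enn_powr (N x) s = (SUP n. enn_powr (\<beta> n x * ?E n h x) s)"
        unfolding N_def using s1 by (intro enn_powr_SUP) auto
      also have "\<dots> = (SUP n. enn_powr (\<beta> n x * ?E n w x) s * enn_powr (?E\<nu> n g x) (r * u))"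
        by (simp add: elim enn_powr_mult ru mult.assoc)
      finally show ?case .
    qed
    then have "(\<integral>\<^sup>+x. enn_powr (N x) s \<partial>M)
        = (\<integral>\<^sup>+x. (SUP n. enn_powr (\<beta> n x * ?E n w x) s * enn_powr (?E\<nu> n g x) (r * u)) \<partial>M)"
      by (rule nn_integral_cong_AE)
    also have "\<dots> \<le> (enn_powr c s * ?D s * A) * ennreal u
        * enn_powr (\<integral>\<^sup>+x. enn_powr (SUP n. ?E\<nu> n g x) r \<partial>density M w) u"
    proof (rule nn_integral_maximal_Carleson)
      fix k E assume E: "E \<in> sets (G k)"
      have "(\<integral>\<^sup>+x\<in>E. (SUP j. enn_powr (\<beta> (k + j) x * ?E (k + j) w x) s) \<partial>M)
          \<le> enn_powr c s * ?D s * (\<integral>\<^sup>+x\<in>E. enn_powr (tail_op \<alpha> k w x) s \<partial>M)"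
        by (rule set_nn_integral_maximal_tail_le[OF E _ s1(1)]) measurable
      also have "\<dots> \<le> enn_powr c s * ?D s * (A * enn_powr (emeasure (density M w) E) u)"
        by (intro mult_left_mono test E) simp
      finally show "(\<integral>\<^sup>+x\<in>E. (SUP j. enn_powr (\<beta> (k + j) x * ?E (k + j) w x) s) \<partial>M)
          \<le> (enn_powr c s * ?D s * A) * enn_powr (emeasure (density M w) E) u"
        by (simp add: mult.assoc)
    qed (use r u \<nu>.sigma_finite_measure_axioms in auto)
    also have "\<dots> \<le> enn_powr c s * ?D s * A * ennreal u
        * enn_powr (?D r * (\<integral>\<^sup>+x. enn_powr (g x) r \<partial>density M w)) u"
      using u r by (intro mult_left_mono enn_powr_mono \<nu>.Doob_maximal) auto
    finally show ?thesis .
  qed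

  have "(\<integral>\<^sup>+x. tail_op \<alpha> 0 f x * (w x * g x) \<partial>M) = (\<integral>\<^sup>+x. (\<Sum>j. \<alpha> j x * ?E j f x * h x) \<partial>M)"
    by (simp add: tail_op_def h_def)
  also have "\<dots> = (\<Sum>j. \<integral>\<^sup>+x. \<alpha> j x * ?E j f x * h x \<partial>M)"
    by (rule nn_integral_suminf) measurable
  also have "\<dots> = (\<Sum>j. \<integral>\<^sup>+x. \<alpha> j x * ?E j h x * ?E j f x \<partial>M)"
  \<comment> \<open>\<open>\<alpha> j\<close> times the conditional expectation of f is measurable
    for \<open>G j\<close>, so h may be replaced by its conditional expectation.\<close>
  proof (rule suminf_cong)
    fix j
    have "(\<integral>\<^sup>+x. \<alpha> j x * ?E j f x * ?E j h x \<partial>M) = (\<integral>\<^sup>+x. \<alpha> j x * ?E j f x * h x \<partial>M)"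
    proof (rule sigma_finite_subalgebra.nn_cond_exp_intg[OF subalg])
      note \<alpha>_meas [measurable]
      show "(\<lambda>x. \<alpha> j x * ?E j f x) \<in> borel_measurable (G j)" by measurable
    qed measurable
    then show "(\<integral>\<^sup>+x. \<alpha> j x * ?E j f x * h x \<partial>M) = (\<integral>\<^sup>+x. \<alpha> j x * ?E j h x * ?E j f x \<partial>M)"
      by (simp add: mult_ac)
  qed
  also have "\<dots> \<le> (\<integral>\<^sup>+x. (c * N x) * (SUP n. ?E n f x) \<partial>M)"
  proof (rule nn_integral_Carleson)
    fix k E assume E: "E \<in> sets (G k)"
    have "(\<integral>\<^sup>+x\<in>E. (\<Sum>j. \<alpha> (k + j) x * ?E (k + j) h x) \<partial>M) \<le> (\<integral>\<^sup>+x\<in>E. c * (\<beta> k x * ?E k h x) \<partial>M)"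
      using set_nn_integral_tail_op_le[OF E, of h] unfolding tail_op_def by simp
    also have "\<dots> \<le> (\<integral>\<^sup>+x\<in>E. c * N x \<partial>M)"
      unfolding N_def by (intro nn_integral_mono mult_right_mono mult_left_mono SUP_upper) auto
    finally show "(\<integral>\<^sup>+x\<in>E. (\<Sum>j. \<alpha> (k + j) x * ?E (k + j) h x) \<partial>M) \<le> (\<integral>\<^sup>+x\<in>E. c * N x \<partial>M)" .
  qed measurable
  also have "\<dots> = c * (\<integral>\<^sup>+x. N x * (SUP n. ?E n f x) \<partial>M)"
    unfolding mult.assoc by (rule nn_integral_cmult) measurable
  also have "\<dots> \<le> c * (enn_powr (\<integral>\<^sup>+x. enn_powr (N x) s \<partial>M) (1 / s)
      * enn_powr (\<integral>\<^sup>+x. enn_powr (SUP n. ?E n f x) p \<partial>M) (1 / p))"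
    by (intro mult_left_mono nn_integral_Holder) (use s1 p in auto)
  also have "\<dots> \<le> c * (enn_powr (enn_powr c s * ?D s * A * ennreal u
        * enn_powr (?D r * (\<integral>\<^sup>+x. enn_powr (g x) r \<partial>density M w)) u) (1 / s)
      * enn_powr (?D p * (\<integral>\<^sup>+x. enn_powr (f x) p \<partial>M)) (1 / p))"
    by (intro mult_mono enn_powr_mono N_bound Doob_maximal order_refl) (use s1 p in auto)
  also have "\<dots> = bilinear_const p r s u * enn_powr A (1 / s)
       * enn_powr (\<integral>\<^sup>+x. enn_powr (f x) p \<partial>M) (1 / p)
       * enn_powr (\<integral>\<^sup>+x. enn_powr (g x) r \<partial>density M w) (1 / r)"
  proof -
    \<comment> \<open>The root 1 / s turns the power u into the norm exponent 1 / r.\<close>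
    have us: "u * (1 / s) = 1 / r" using u r unfolding ru by (simp add: field_simps)
    show ?thesis
      unfolding bilinear_const_def enn_powr_mult enn_powr_powr us by (simp only: mult_ac)
  qed
  finally show ?thesis .
qed

end

section \<open>Series over the integers and locally finite conditional expectations\<close>

lemma infsum_ennreal_int_atLeast:
  fixes f :: "int \<Rightarrow> ennreal"
  shows "(\<Sum>\<^sub>\<infinity>j\<in>{i..}. f j) = (\<Sum>k. f (i + int k))"
proof -
  have "bij_betw (\<lambda>k. i + int k) UNIV {i..}"
    by (rule bij_betwI[where g = "\<lambda>j. nat (j - i)"]) auto
  then have "(\<Sum>\<^sub>\<infinity>j\<in>{i..}. f j) = (\<Sum>\<^sub>\<infinity>k\<in>UNIV. f (i + int k))"
    by (rule infsum_reindex_bij_betw[symmetric])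
  also have "\<dots> = (\<Sum>k. f (i + int k))"
    by (rule sums_unique, rule has_sum_imp_sums, rule has_sum_infsum, rule nonneg_summable_on_complete) simp
  finally show ?thesis .
qed

lemma ennreal_infsum:
  fixes f :: "'b \<Rightarrow> real"
  assumes "f summable_on A" "\<And>x. x \<in> A \<Longrightarrow> 0 \<le> f x"
  shows "ennreal (infsum f A) = (\<Sum>\<^sub>\<infinity>x\<in>A. ennreal (f x))"
proof -
  have "(\<Sum>\<^sub>\<infinity>x\<in>A. ennreal (f x)) = (SUP S\<in>{S. finite S \<and> S \<subseteq> A}. \<Sum>x\<in>S. ennreal (f x))"
    by (rule nonneg_infsum_complete) simp
  also have "\<dots> = (SUP S\<in>{S. finite S \<and> S \<subseteq> A}. ennreal (sum f S))"
    using assms by (intro SUP_cong refl sum_ennreal) auto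
  finally show ?thesis using infsum_nonneg_is_SUPREMUM_ennreal[OF assms] by simp
qed

lemma sum_int_le_suminf:
  fixes f :: "int \<Rightarrow> ennreal"
  assumes "finite S" "\<And>j. j \<in> S \<Longrightarrow> i \<le> j"
  shows "sum f S \<le> (\<Sum>k. f (i + int k))"
  unfolding infsum_ennreal_int_atLeast[symmetric]
  by (subst nonneg_infsum_complete) (use assms in \<open>auto intro!: SUP_upper\<close>)

text \<open>A finite set of integers lies above some -N, so a uniform bound on the tails bounds all
  finite sums of absolute values.\<close>

lemma summable_on_int_if_tails_bounded:
  fixes g :: "int \<Rightarrow> real"
  assumes bound: "\<And>N. (\<Sum>k. ennreal \<bar>g (- int N + int k)\<bar>) \<le> ennreal v" and "0 \<le> v"
  shows "g summable_on UNIV" and "\<bar>\<Sum>\<^sub>\<infinity>j. g j\<bar> \<le> v"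
proof -
  have le: "(\<Sum>j\<in>S. \<bar>g j\<bar>) \<le> v" if S: "finite S" for S
  proof -
    have "bdd_below (S :: int set)" using S by (rule bdd_below_finite)
    then obtain m where m: "\<And>j. j \<in> S \<Longrightarrow> m \<le> j" by (auto simp: bdd_below_def)
    have "ennreal (\<Sum>j\<in>S. \<bar>g j\<bar>) = (\<Sum>j\<in>S. ennreal \<bar>g j\<bar>)" by simp
    \<comment> \<open>The starting point \<open>- int (nat (- m))\<close> is at most m for either
      sign of m.\<close>
    also have "\<dots> \<le> (\<Sum>k. ennreal \<bar>g (- int (nat (- m)) + int k)\<bar>)"
      using m by (intro sum_int_le_suminf[OF S]) fastforce
    also have "\<dots> \<le> ennreal v" by (rule bound)
    finally show ?thesis using \<open>0 \<le> v\<close> by simp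
  qed
  have abs: "(\<lambda>j. norm (g j)) summable_on UNIV"
    by (rule nonneg_bdd_above_summable_on) (auto intro!: bdd_aboveI2[where M = v] le)
  then show "g summable_on UNIV" by (rule abs_summable_summable)
  have "norm (\<Sum>\<^sub>\<infinity>j. g j) \<le> (\<Sum>\<^sub>\<infinity>j. norm (g j))" by (rule norm_infsum_bound[OF abs])
  also have "\<dots> \<le> v" by (rule infsum_le_finite_sums[OF abs]) (simp add: le)
  finally show "\<bar>\<Sum>\<^sub>\<infinity>j. g j\<bar> \<le> v" by simp
qed

lemma suminf_int_le_infsum:
  fixes g :: "int \<Rightarrow> real"
  assumes g: "g summable_on UNIV" and nonneg: "\<And>j. 0 \<le> g j"
  shows "(\<Sum>k. ennreal (g (i + int k))) \<le> ennreal (\<Sum>\<^sub>\<infinity>j. g j)"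
proof -
  have "(\<Sum>k. ennreal (g (i + int k))) = (\<Sum>\<^sub>\<infinity>j\<in>{i..}. ennreal (g j))"
    by (rule infsum_ennreal_int_atLeast[symmetric])
  also have "\<dots> \<le> (\<Sum>\<^sub>\<infinity>j. ennreal (g j))"
    by (rule infsum_mono_neutral) (auto intro: nonneg_summable_on_complete)
  finally show ?thesis using ennreal_infsum[OF g] nonneg by simp
qed

section \<open>Local integrability, densities and exhaustion by sets of finite measure\<close>

context sigma_finite_subalgebra
begin

lemma finite_sets_cover:
  obtains A :: "nat \<Rightarrow> 'a set" where "range A \<subseteq> finite_sets M F" "(\<Union>n. A n) = space M" "incseq A"
proof -
  obtain A :: "nat \<Rightarrow> 'a set" where A: "range A \<subseteq> sets (restr_to_subalg M F)"
    "(\<Union>n. A n) = space (restr_to_subalg M F)"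
    "\<And>n. emeasure (restr_to_subalg M F) (A n) \<noteq> \<infinity>" "incseq A"
    using sigma_finite_measure.sigma_finite_incseq[OF sigma_fin_subalg] by blast
  have "A n \<in> finite_sets M F" for n
    using A(1) A(3)[of n] subalg
    by (auto simp: finite_sets_def less_top sets_restr_to_subalg emeasure_restr_to_subalg range_subsetD)
  then show ?thesis
    using A(2,4) by (intro that[of A]) (auto simp: space_restr_to_subalg)
qed

lemma finite_setsD: "E \<in> finite_sets M F \<Longrightarrow> E \<in> sets M"
  using subalg by (auto simp: finite_sets_def subalgebra_def)

lemma nn_cond_exp_finite_AE:
  assumes [measurable]: "f \<in> borel_measurable M"
    and fin: "\<And>E. E \<in> finite_sets M F \<Longrightarrow> (\<integral>\<^sup>+x\<in>E. f x \<partial>M) < \<infinity>"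
  shows "AE x in M. nn_cond_exp M F f x < \<infinity>"
proof -
  obtain A :: "nat \<Rightarrow> 'a set" where range_A: "range A \<subseteq> finite_sets M F"
    and A: "(\<Union>n. A n) = space M" "incseq A"
    by (rule finite_sets_cover)
  then have Afin: "A n \<in> finite_sets M F" for n by auto
  have "AE x in M. \<forall>n. nn_cond_exp M F f x * indicator (A n) x \<noteq> \<infinity>"
  proof (intro AE_all_countable[THEN iffD2] allI)
    fix n
    have [measurable]: "A n \<in> sets F" "A n \<in> sets M"
      using Afin[of n] finite_setsD by (auto simp: finite_sets_def)
    have "(\<integral>\<^sup>+x. nn_cond_exp M F f x * indicator (A n) x \<partial>M) = (\<integral>\<^sup>+x\<in>A n. f x \<partial>M)"
      using nn_cond_exp_intg[of "indicator (A n)" f] by (simp add: mult.commute)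
    then show "AE x in M. nn_cond_exp M F f x * indicator (A n) x \<noteq> \<infinity>"
      using fin[OF Afin, of n] by (intro nn_integral_PInf_AE) auto
  qed
  then show ?thesis
  proof (rule AE_mp, intro AE_I2 impI)
    fix x assume "x \<in> space M" and x: "\<forall>n. nn_cond_exp M F f x * indicator (A n) x \<noteq> \<infinity>"
    then have "x \<in> (\<Union>n. A n)" by (simp only: A(1))
    then obtain n where "x \<in> A n" by (rule UN_E)
    then show "nn_cond_exp M F f x < \<infinity>"
      using spec[OF x, of n] by (simp add: less_top)
  qed
qed

text \<open>\<open>real_cond_exp\<close> is a difference of two \<open>nn_cond_exp\<close> passed
  through \<open>enn2real\<close>. For nonnegative f the second is 0, and local integrability makes
  the first finite almost everywhere, so nothing is lost.\<close>

lemma real_cond_exp_eq_nn_cond_exp: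
  fixes f :: "'a \<Rightarrow> real"
  assumes [measurable]: "f \<in> borel_measurable M" and nonneg: "\<And>x. x \<in> space M \<Longrightarrow> 0 \<le> f x"
    and int: "\<And>E. E \<in> finite_sets M F \<Longrightarrow> set_integrable M E f"
  shows "AE x in M. 0 \<le> real_cond_exp M F f x \<and>
    ennreal (real_cond_exp M F f x) = nn_cond_exp M F (\<lambda>x. ennreal (f x)) x"
proof -
  have "AE x in M. nn_cond_exp M F (\<lambda>x. ennreal (f x)) x < \<infinity>"
  proof (rule nn_cond_exp_finite_AE)
    fix E assume E: "E \<in> finite_sets M F"
    have "(\<integral>\<^sup>+x\<in>E. ennreal (f x) \<partial>M) = (\<integral>\<^sup>+x. ennreal (norm (indicator E x *\<^sub>R f x)) \<partial>M)"
      using nonneg by (intro nn_integral_cong) (auto split: split_indicator)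
    also have "\<dots> < \<infinity>" using int[OF E] by (simp add: set_integrable_def integrable_iff_bounded)
    finally show "(\<integral>\<^sup>+x\<in>E. ennreal (f x) \<partial>M) < \<infinity>" .
  qed measurable
  moreover have "AE x in M. nn_cond_exp M F (\<lambda>x. ennreal (- f x)) x = nn_cond_exp M F (\<lambda>_. 0) x"
    using nonneg by (intro nn_cond_exp_cong AE_I2) (auto simp: ennreal_neg)
  moreover have "AE x in M. 0 = nn_cond_exp M F (\<lambda>_. 0) x"
    by (rule nn_cond_exp_F_meas) simp
  ultimately show ?thesis
    by eventually_elim (simp add: real_cond_exp_def)
qed

text \<open>By \<open>fin\<close>, an exhaustion by sets of finite measure also has finite weighted
  measure. This makes conditional expectations and Doob's inequality available for the
  weight.\<close>

lemma sigma_finite_subalgebra_density: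
  assumes [measurable]: "w \<in> borel_measurable M"
    and fin: "\<And>E. E \<in> finite_sets M F \<Longrightarrow> (\<integral>\<^sup>+x\<in>E. w x \<partial>M) < \<infinity>"
  shows "sigma_finite_subalgebra (density M w) F"
proof (rule sigma_finite_subalgebra.intro)
  show sub: "subalgebra (density M w) F"
    using subalg by (simp add: subalgebra_def)
  obtain A :: "nat \<Rightarrow> 'a set" where range_A: "range A \<subseteq> finite_sets M F"
    and A: "(\<Union>n. A n) = space M" "incseq A"
    by (rule finite_sets_cover)
  then have Afin: "A n \<in> finite_sets M F" for n by auto
  have AF: "A n \<in> sets F" "A n \<in> sets M" for n
    using Afin[of n] finite_setsD by (auto simp: finite_sets_def)
  show "sigma_finite_measure (restr_to_subalg (density M w) F)"
  proof (intro sigma_finite_measure.intro exI[of _ "range A"] conjI ballI)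
    show "countable (range A)" by simp
    show "range A \<subseteq> sets (restr_to_subalg (density M w) F)"
      using AF sub by (auto simp: sets_restr_to_subalg)
    show "\<Union> (range A) = space (restr_to_subalg (density M w) F)"
      using A(1) by (simp add: space_restr_to_subalg)
    fix a assume "a \<in> range A"
    then obtain n where a: "a = A n" by blast
    have "emeasure (restr_to_subalg (density M w) F) a = (\<integral>\<^sup>+x\<in>A n. w x \<partial>M)"
      using AF[of n] sub by (simp add: a emeasure_restr_to_subalg emeasure_density)
    also have "\<dots> < \<infinity>" by (rule fin[OF Afin])
    finally show "emeasure (restr_to_subalg (density M w) F) a \<noteq> \<infinity>" by simp
  qed
qed

text \<open>The testing condition concerns sets of finite measure, whereas stopping events may have
  infinite measure; monotone convergence along \<open>E \<inter> B n\<close> bridges the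
  gap.\<close>

lemma set_nn_integral_le_powr_extend:
  assumes [measurable]: "f \<in> borel_measurable M"
    and sets_\<nu>: "sets \<nu> = sets M" and "0 \<le> u"
    and fin: "\<And>E. E \<in> finite_sets M F \<Longrightarrow> (\<integral>\<^sup>+x\<in>E. f x \<partial>M) \<le> A * enn_powr (emeasure \<nu> E) u"
    and E: "E \<in> sets F"
  shows "(\<integral>\<^sup>+x\<in>E. f x \<partial>M) \<le> A * enn_powr (emeasure \<nu> E) u"
proof -
  obtain B :: "nat \<Rightarrow> 'a set" where range_B: "range B \<subseteq> finite_sets M F"
    and B: "(\<Union>n. B n) = space M" "incseq B"
    by (rule finite_sets_cover)
  then have Bfin: "B n \<in> finite_sets M F" for n by auto
  have EM [measurable]: "E \<in> sets M" using E subalg by (auto simp: subalgebra_def)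
  have BM [measurable]: "B n \<in> sets M" for n using Bfin by (rule finite_setsD)
  have EB: "E \<inter> B n \<in> finite_sets M F" for n
  proof -
    have "emeasure M (E \<inter> B n) \<le> emeasure M (B n)" by (rule emeasure_mono) auto
    then show ?thesis using E Bfin[of n] by (auto simp: finite_sets_def)
  qed
  have "(\<integral>\<^sup>+x\<in>E. f x \<partial>M) = (\<integral>\<^sup>+x. (SUP n. f x * indicator (E \<inter> B n) x) \<partial>M)"
  proof (rule nn_integral_cong)
    fix x assume "x \<in> space M"
    then have "x \<in> (\<Union>n. B n)" by (simp only: B(1))
    then obtain n where n: "x \<in> B n" by (rule UN_E)
    show "f x * indicator E x = (SUP n. f x * indicator (E \<inter> B n) x)"
    proof (rule antisym)
      show "f x * indicator E x \<le> (SUP n. f x * indicator (E \<inter> B n) x)"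
        using n by (intro SUP_upper2[of n]) (auto split: split_indicator)
      show "(SUP n. f x * indicator (E \<inter> B n) x) \<le> f x * indicator E x"
        by (intro SUP_least) (auto split: split_indicator)
    qed
  qed
  also have "\<dots> = (SUP n. \<integral>\<^sup>+x\<in>E \<inter> B n. f x \<partial>M)"
  proof (rule nn_integral_monotone_convergence_SUP)
    show "incseq (\<lambda>n x. f x * indicator (E \<inter> B n) x)"
    proof (intro incseq_SucI le_funI mult_left_mono)
      fix n x
      show "indicator (E \<inter> B n) x \<le> (indicator (E \<inter> B (Suc n)) x :: ennreal)"
        using incseq_SucD[OF B(2), of n] by (auto split: split_indicator)
    qed simp
  qed measurable
  also have "\<dots> \<le> A * enn_powr (emeasure \<nu> E) u"
  proof (rule SUP_least)
    fix n
    have "(\<integral>\<^sup>+x\<in>E \<inter> B n. f x \<partial>M) \<le> A * enn_powr (emeasure \<nu> (E \<inter> B n)) u"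
      by (rule fin[OF EB])
    also have "\<dots> \<le> A * enn_powr (emeasure \<nu> E) u"
      using EM \<open>0 \<le> u\<close> by (intro mult_left_mono enn_powr_mono emeasure_mono) (auto simp: sets_\<nu>)
    finally show "(\<integral>\<^sup>+x\<in>E \<inter> B n. f x \<partial>M) \<le> A * enn_powr (emeasure \<nu> E) u" .
  qed
  finally show ?thesis .
qed

end

text \<open>Pointwise |f| <= 1 + |f|^p, and 1 is integrable over E.\<close>

lemma set_integrable_Lp_space:
  assumes f: "f \<in> Lp_space p M" and p: "1 < p" and [measurable]: "E \<in> sets M" and E: "emeasure M E < \<infinity>"
  shows "set_integrable M E f"
  unfolding set_integrable_def
proof (rule integrableI_bounded)
  have [measurable]: "f \<in> borel_measurable M" using f by (simp add: Lp_space_def)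
  show "(\<lambda>x. indicator E x *\<^sub>R f x) \<in> borel_measurable M" by measurable
  have "ennreal (norm (indicator E x *\<^sub>R f x)) \<le> indicator E x + ennreal (\<bar>f x\<bar> powr p)" for x
  proof -
    have "\<bar>f x\<bar> \<le> 1 + \<bar>f x\<bar> powr p"
    proof (cases "\<bar>f x\<bar> \<le> 1")
      case False
      then have "\<bar>f x\<bar> powr 1 \<le> \<bar>f x\<bar> powr p" using p by (intro powr_mono) auto
      then show ?thesis using False by simp
    qed (simp add: add_increasing2)
    then have "ennreal \<bar>f x\<bar> \<le> 1 + ennreal (\<bar>f x\<bar> powr p)"
      by (metis ennreal_1 ennreal_leI ennreal_plus powr_ge_zero zero_le_one)
    then show ?thesis by (auto split: split_indicator)
  qed
  then have "(\<integral>\<^sup>+x. ennreal (norm (indicator E x *\<^sub>R f x)) \<partial>M) \<le> (\<integral>\<^sup>+x. indicator E x + ennreal (\<bar>f x\<bar> powr p) \<partial>M)"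
    by (rule nn_integral_mono)
  also have "\<dots> = emeasure M E + (\<integral>\<^sup>+x. ennreal (\<bar>f x\<bar> powr p) \<partial>M)"
    by (subst nn_integral_add) auto
  also have "\<dots> < \<infinity>"
    using f E by (simp add: Lp_space_def Lp_norm_def less_top)
  finally show "(\<integral>\<^sup>+x. ennreal (norm (indicator E x *\<^sub>R f x)) \<partial>M) < \<infinity>" .
qed

section \<open>From the testing condition to the operator and back\<close>

context sigma_finite_filtered_measure
begin

section \<open>Shifts of the integer filtration and transfer of the hypotheses\<close>

lemma nat_filtration_shift: "nat_filtration M (\<lambda>n. F (i + int n))"
proof (rule nat_filtration.intro)
  fix m n :: nat assume "m \<le> n"
  then show "sets (F (i + int m)) \<subseteq> sets (F (i + int n))"
    using filtered[of "i + int m" "i + int n"] by (cases "m = n") auto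
qed (rule sigma_finite_sub)

lemma finite_setsD: "E \<in> finite_sets M (F i) \<Longrightarrow> E \<in> sets M"
  using sigma_finite_subalgebra.finite_setsD[OF sigma_finite_sub] .

lemma weights_measurable: "w \<in> weights M F \<Longrightarrow> w \<in> borel_measurable M"
  by (simp add: weights_def loc_integrable_def)

lemma real_cond_exp_weights:
  assumes "w \<in> weights M F"
  shows "AE x in M. 0 \<le> real_cond_exp M (F i) w x \<and>
    ennreal (real_cond_exp M (F i) w x) = nn_cond_exp M (F i) (\<lambda>x. ennreal (w x)) x"
  using assms
  by (intro sigma_finite_subalgebra.real_cond_exp_eq_nn_cond_exp[OF sigma_finite_sub])
     (auto simp: weights_def loc_integrable_def)

lemma weights_finite:
  assumes "w \<in> weights M F" "E \<in> finite_sets M (F i)"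
  shows "(\<integral>\<^sup>+x\<in>E. ennreal (w x) \<partial>M) < \<infinity>"
proof -
  have "(\<integral>\<^sup>+x\<in>E. ennreal (w x) \<partial>M) = (\<integral>\<^sup>+x. ennreal (norm (indicator E x *\<^sub>R w x)) \<partial>M)"
    using assms(1) by (intro nn_integral_cong) (auto simp: weights_def split: split_indicator)
  also have "\<dots> < \<infinity>"
    using assms by (auto simp: weights_def loc_integrable_def set_integrable_def integrable_iff_bounded)
  finally show ?thesis .
qed

lemma filtered_density:
  assumes w: "w \<in> weights M F"
  shows "sigma_finite_filtered_measure (density M (\<lambda>x. ennreal (w x))) F"
proof -
  have [measurable]: "w \<in> borel_measurable M" using w by (rule weights_measurable)
  have sub: "sigma_finite_subalgebra (density M (\<lambda>x. ennreal (w x))) (F i)" for i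
    using weights_finite[OF w]
    by (intro sigma_finite_subalgebra.sigma_finite_subalgebra_density[OF sigma_finite_sub]) auto
  show ?thesis
    by (intro sigma_finite_filtered_measure.intro sigma_finite_filtered_measure_axioms.intro
        sigma_finite_subalgebra_is_sigma_finite[OF sub[of 0]] sub filtered)
qed

text \<open>The operator restricted to times from i on, valued in \<open>ennreal\<close> so that
  convergence is no issue.\<close>

definition nn_T_tail :: "(int \<Rightarrow> 'a \<Rightarrow> real) \<Rightarrow> int \<Rightarrow> ('a \<Rightarrow> ennreal) \<Rightarrow> 'a \<Rightarrow> ennreal" where
  "nn_T_tail \<alpha> i h x = (\<Sum>k. ennreal (\<alpha> (i + int k) x) * nn_cond_exp M (F (i + int k)) h x)"

lemma nn_T_tail_eq_tail_op:
  "nn_T_tail \<alpha> (i + int n) h x = nat_filtration.tail_op M (\<lambda>n. F (i + int n)) (\<lambda>n x. ennreal (\<alpha> (i + int n) x)) n h x"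
  unfolding nn_T_tail_def nat_filtration.tail_op_def[OF nat_filtration_shift] by (simp add: add.assoc)

lemma admissible_measurable: "admissible M F \<alpha> \<Longrightarrow> \<alpha> i \<in> borel_measurable (F i)"
  by (simp add: admissible_def)

lemma admissible_measurable_M: "admissible M F \<alpha> \<Longrightarrow> \<alpha> i \<in> borel_measurable M"
  using measurable_from_subalg[OF sigma_finite_subalgebra.subalg[OF sigma_finite_sub] admissible_measurable] .

lemma admissible_nonneg: "admissible M F \<alpha> \<Longrightarrow> x \<in> space M \<Longrightarrow> 0 \<le> \<alpha> i x"
  by (simp add: admissible_def)

lemma nn_T_tail_measurable:
  assumes "admissible M F \<alpha>"
  shows "nn_T_tail \<alpha> i h \<in> borel_measurable M"
proof -
  note admissible_measurable_M[OF assms, measurable]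
  show ?thesis unfolding nn_T_tail_def by measurable
qed

lemma nn_T_tail_mono_index:
  assumes "i \<le> j"
  shows "nn_T_tail \<alpha> j h x \<le> nn_T_tail \<alpha> i h x"
proof -
  obtain n where n: "j = i + int n" using assms zle_iff_zadd by blast
  show ?thesis
    unfolding nn_T_tail_def n by (subst (2) suminf_offset[where i = n]) (auto simp: add_ac)
qed

lemma AE_all_real_cond_exp_weights:
  assumes "w \<in> weights M F"
  shows "AE x in M. \<forall>j. 0 \<le> real_cond_exp M (F j) w x \<and>
    ennreal (real_cond_exp M (F j) w x) = nn_cond_exp M (F j) (\<lambda>x. ennreal (w x)) x"
  using real_cond_exp_weights[OF assms] by (intro AE_all_countable[THEN iffD2] allI)

lemma testing_condition_iff:
  assumes \<alpha>: "admissible M F \<alpha>" and w: "w \<in> weights M F"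
  shows "testing_condition M F \<alpha> p q w C \<longleftrightarrow>
    (\<forall>i. \<forall>E \<in> finite_sets M (F i).
      enn_powr (\<integral>\<^sup>+x\<in>E. enn_powr (nn_T_tail \<alpha> i (\<lambda>x. ennreal (w x)) x) (conj_exp p) \<partial>M) (1 / conj_exp p)
      \<le> ennreal C * enn_powr (emeasure (density M (\<lambda>x. ennreal (w x))) E) (1 / conj_exp q))"
proof -
  have [measurable]: "w \<in> borel_measurable M" using w by (rule weights_measurable)
  \<comment> \<open>One null set serves all times; off it the real conditional expectations of w are
    nonnegative, so \<open>ennreal\<close> is multiplicative on each term.\<close>
  have "AE x in M. \<forall>i. (\<Sum>\<^sub>\<infinity>j\<in>{i..}. ennreal (\<alpha> j x * real_cond_exp M (F j) w x))
      = nn_T_tail \<alpha> i (\<lambda>x. ennreal (w x)) x"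
    using AE_all_real_cond_exp_weights[OF w] AE_space
  proof eventually_elim
    case (elim x)
    then show ?case
      unfolding infsum_ennreal_int_atLeast nn_T_tail_def
      using admissible_nonneg[OF \<alpha>] by (simp add: ennreal_mult)
  qed
  then have eq: "AE x in M. (\<Sum>\<^sub>\<infinity>j\<in>{i..}. ennreal (\<alpha> j x * real_cond_exp M (F j) w x))
      = nn_T_tail \<alpha> i (\<lambda>x. ennreal (w x)) x" for i
    by eventually_elim simp
  have "(\<integral>\<^sup>+x\<in>E. enn_powr (\<Sum>\<^sub>\<infinity>j\<in>{i..}. ennreal (\<alpha> j x * real_cond_exp M (F j) w x)) (conj_exp p) \<partial>M)
      = (\<integral>\<^sup>+x\<in>E. enn_powr (nn_T_tail \<alpha> i (\<lambda>x. ennreal (w x)) x) (conj_exp p) \<partial>M)" for i E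
    using eq[of i] by (intro nn_integral_cong_AE) auto
  moreover have "(\<integral>\<^sup>+x\<in>E. ennreal (w x) \<partial>M) = emeasure (density M (\<lambda>x. ennreal (w x))) E"
    if "E \<in> finite_sets M (F i)" for E i
    using finite_setsD[OF that] by (simp add: emeasure_density)
  ultimately show ?thesis
    unfolding testing_condition_def by (metis (no_types, lifting))
qed

lemma AE_alpha_bar:
  assumes \<alpha>: "admissible M F \<alpha>"
  shows "AE x in M. (\<Sum>k. ennreal (\<alpha> (i + int k) x)) = ennreal (alpha_bar \<alpha> i x)"
proof -
  have "AE x in M. (\<lambda>j. \<alpha> j x) summable_on {i..}" using \<alpha> by (simp add: admissible_def)
  with AE_space show ?thesis
  proof eventually_elim
    case (elim x)
    show ?case
      unfolding alpha_bar_def infsum_ennreal_int_atLeast[of "\<lambda>j. ennreal (\<alpha> j x)" i, symmetric]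
      using elim admissible_nonneg[OF \<alpha>] by (simp add: ennreal_infsum)
  qed
qed

text \<open>The constant c is the same for every start i, which keeps the later bounds uniform as i
  tends to minus infinity.\<close>

lemma nat_filtration_coeff_shift:
  assumes \<alpha>: "admissible M F \<alpha>" and "0 < c"
    and c: "\<And>i. AE x in M. alpha_bar \<alpha> i x / c \<le> real_cond_exp M (F i) (alpha_bar \<alpha> i) x \<and>
        real_cond_exp M (F i) (alpha_bar \<alpha> i) x \<le> c * alpha_bar \<alpha> i x"
  shows "nat_filtration_coeff M (\<lambda>n. F (i + int n)) (\<lambda>n x. ennreal (\<alpha> (i + int n) x)) (ennreal c)"
proof -
  interpret nat_filtration M "\<lambda>n. F (i + int n)" by (rule nat_filtration_shift)
  let ?t = "tail_sum (\<lambda>n x. ennreal (\<alpha> (i + int n) x))"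
  note admissible_measurable_M[OF \<alpha>, measurable]
  have w: "alpha_bar \<alpha> j \<in> weights M F" for j using \<alpha> by (simp add: admissible_def)
  have t: "AE x in M. ?t n x = ennreal (alpha_bar \<alpha> (i + int n) x)" for n
    using AE_alpha_bar[OF \<alpha>, of "i + int n"] unfolding tail_sum_def by (simp add: add.assoc)
  have [measurable]: "?t n \<in> borel_measurable M" for n unfolding tail_sum_def by measurable
  have both: "AE x in M. ?t n x \<le> ennreal c * nn_cond_exp M (F (i + int n)) (?t n) x \<and>
      nn_cond_exp M (F (i + int n)) (?t n) x \<le> ennreal c * ?t n x" for n
  proof -
    have "AE x in M. nn_cond_exp M (F (i + int n)) (?t n) x
        = nn_cond_exp M (F (i + int n)) (\<lambda>x. ennreal (alpha_bar \<alpha> (i + int n) x)) x"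
      using weights_measurable[OF w]
      by (intro sigma_finite_subalgebra.nn_cond_exp_cong[OF sigma_finite_sub] t) auto
    then show ?thesis
      using real_cond_exp_weights[OF w[of "i + int n"], of "i + int n"] c[of "i + int n"] t[of n] AE_space
    proof eventually_elim
      case (elim x)
      let ?a = "alpha_bar \<alpha> (i + int n) x" and ?r = "real_cond_exp M (F (i + int n)) (alpha_bar \<alpha> (i + int n)) x"
      have a: "0 \<le> ?a" using w elim by (simp add: weights_def)
      have "?a \<le> c * ?r" "?r \<le> c * ?a"
        using elim \<open>0 < c\<close> by (auto simp: field_simps)
      then have "ennreal ?a \<le> ennreal (c * ?r)" "ennreal ?r \<le> ennreal (c * ?a)"
        by (auto intro!: ennreal_leI)
      moreover have "ennreal (c * ?r) = ennreal c * ennreal ?r" "ennreal (c * ?a) = ennreal c * ennreal ?a"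
        using elim a \<open>0 < c\<close> by (simp_all add: ennreal_mult)
      moreover have "?t n x = ennreal ?a" "nn_cond_exp M (F (i + int n)) (?t n) x = ennreal ?r"
        using elim by simp_all
      ultimately show ?case by (simp only:)
    qed
  qed
  show ?thesis
  proof unfold_locales
    fix n
    note admissible_measurable[OF \<alpha>, measurable]
    show "(\<lambda>x. ennreal (\<alpha> (i + int n) x)) \<in> borel_measurable (F (i + int n))" by measurable
    show "AE x in M. ?t n x \<le> ennreal c * nn_cond_exp M (F (i + int n)) (?t n) x"
      "AE x in M. nn_cond_exp M (F (i + int n)) (?t n) x \<le> ennreal c * ?t n x"
      using both[of n] by (auto elim!: eventually_mono)
  qed
qed

end

lemma conj_exp_gt_1: "1 < p \<Longrightarrow> 1 < conj_exp p"
  by (simp add: conj_exp_def)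

lemma conj_exp_conj_exp: "1 < p \<Longrightarrow> conj_exp (conj_exp p) = p"
  by (simp add: conj_exp_def field_simps)

lemma inverse_add_inverse_conj_exp: "1 < p \<Longrightarrow> 1 / p + 1 / conj_exp p = 1"
  by (simp add: conj_exp_def field_simps)

lemma conj_exp_antimono: "1 < p \<Longrightarrow> p \<le> q \<Longrightarrow> conj_exp q \<le> conj_exp p"
  by (simp add: conj_exp_def field_simps)

lemma Lp_norm_eq: "Lp_norm p M f = enn_powr (\<integral>\<^sup>+x. enn_powr (ennreal \<bar>f x\<bar>) p \<partial>M) (1 / p)"
  by (simp add: Lp_norm_def enn_powr_ennreal)

context sigma_finite_filtered_measure
begin

text \<open>The testing norm is dualised against g in L^p. Moving conditional expectations from w to
  g yields the weighted integral over E of a tail of the operator applied to g; Hoelder's inequality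
  and the norm inequality for g finish, with the same C.\<close>

lemma strong_type_imp_testing:
  assumes \<alpha>: "admissible M F \<alpha>" and w: "w \<in> weights M F" and p: "1 < p" and q: "1 < q"
    and strong: "strong_type M F \<alpha> p q w C"
  shows "testing_condition M F \<alpha> p q w C"
  unfolding testing_condition_iff[OF \<alpha> w]
proof (intro allI ballI)
  fix i E assume E: "E \<in> finite_sets M (F i)"
  define w' where "w' = (\<lambda>x. ennreal (w x))"
  let ?\<nu> = "density M w'"
  let ?U = "\<lambda>x. indicator E x * nn_T_tail \<alpha> i w' x"
  have [measurable]: "w \<in> borel_measurable M" using w by (rule weights_measurable)
  have [measurable]: "w' \<in> borel_measurable M" unfolding w'_def by measurable
  have [measurable]: "E \<in> sets M" using E by (rule finite_setsD)
  note nn_T_tail_measurable[OF \<alpha>, measurable] admissible_measurable_M[OF \<alpha>, measurable]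
  have s: "1 < conj_exp p" using p by (rule conj_exp_gt_1)
  have "enn_powr (\<integral>\<^sup>+x. enn_powr (?U x) (conj_exp p) \<partial>M) (1 / conj_exp p)
      \<le> ennreal C * enn_powr (emeasure ?\<nu> E) (1 / conj_exp q)"
  proof (rule Lp_norm_le_by_duality[OF _ s])
    fix g :: "'a \<Rightarrow> real"
    assume [measurable]: "g \<in> borel_measurable M" and g0: "\<And>x. 0 \<le> g x"
      and "(\<integral>\<^sup>+x. enn_powr (ennreal (g x)) (conj_exp (conj_exp p)) \<partial>M) < top"
    then have gfin: "(\<integral>\<^sup>+x. enn_powr (ennreal (g x)) p \<partial>M) < top" using conj_exp_conj_exp[OF p] by simp
    have norm_g: "Lp_norm p M g = enn_powr (\<integral>\<^sup>+x. enn_powr (ennreal (g x)) p \<partial>M) (1 / p)"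
      by (simp add: Lp_norm_eq g0)
    have g: "g \<in> Lp_space p M" using gfin by (simp add: Lp_space_def norm_g)
    have gw: "g \<in> weights M F"
      using set_integrable_Lp_space[OF g p finite_setsD] g0
      by (auto simp: weights_def loc_integrable_def finite_sets_def)
    let ?g = "\<lambda>x. ennreal (g x)"
    have "AE x in ?\<nu>. \<forall>j. 0 \<le> real_cond_exp M (F j) g x \<and> ennreal (real_cond_exp M (F j) g x) = nn_cond_exp M (F j) ?g x"
      using AE_all_real_cond_exp_weights[OF gw] by (subst AE_density) auto
    \<comment> \<open>Without summability \<open>infsum\<close> would be 0 and the norm of
      \<open>T_op\<close> would not control the tails.\<close>
    moreover have "AE x in ?\<nu>. (\<lambda>i. \<alpha> i x * real_cond_exp M (F i) g x) summable_on UNIV"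
      using strong g unfolding strong_type_def w'_def by blast
    ultimately have T: "AE x in ?\<nu>. nn_T_tail \<alpha> i ?g x \<le> ennreal \<bar>T_op M F \<alpha> g x\<bar>"
      using AE_space
    proof eventually_elim
      case (elim x)
      have nonneg: "0 \<le> \<alpha> j x" for j using elim admissible_nonneg[OF \<alpha>] by simp
      have "nn_T_tail \<alpha> i ?g x = (\<Sum>k. ennreal (\<alpha> (i + int k) x * real_cond_exp M (F (i + int k)) g x))"
        unfolding nn_T_tail_def using elim nonneg by (simp add: ennreal_mult)
      also have "\<dots> \<le> ennreal (T_op M F \<alpha> g x)"
        unfolding T_op_def using elim nonneg
        by (intro suminf_int_le_infsum[of "\<lambda>j. \<alpha> j x * real_cond_exp M (F j) g x"]) auto
      also have "\<dots> \<le> ennreal \<bar>T_op M F \<alpha> g x\<bar>" by (intro ennreal_leI) simp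
      finally show ?case .
    qed
    have T_norm: "enn_powr (\<integral>\<^sup>+x. enn_powr (nn_T_tail \<alpha> i ?g x) q \<partial>?\<nu>) (1 / q) \<le> ennreal C * Lp_norm p M g"
    proof -
      have "enn_powr (\<integral>\<^sup>+x. enn_powr (nn_T_tail \<alpha> i ?g x) q \<partial>?\<nu>) (1 / q) \<le> Lp_norm q ?\<nu> (T_op M F \<alpha> g)"
        unfolding Lp_norm_eq
      proof (intro enn_powr_mono nn_integral_mono_AE)
        show "AE x in ?\<nu>. enn_powr (nn_T_tail \<alpha> i ?g x) q \<le> enn_powr (ennreal \<bar>T_op M F \<alpha> g x\<bar>) q"
          using T by eventually_elim (use q in \<open>auto intro: enn_powr_mono\<close>)
      qed (use q in auto)
      also have "\<dots> \<le> ennreal C * Lp_norm p M g"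
        using strong g unfolding strong_type_def w'_def by blast
      finally show ?thesis .
    qed
    have "(\<integral>\<^sup>+x. ?U x * ?g x \<partial>M)
        = (\<integral>\<^sup>+x. (\<Sum>k. (indicator E x * ennreal (\<alpha> (i + int k) x) * ?g x) * nn_cond_exp M (F (i + int k)) w' x) \<partial>M)"
    proof (intro nn_integral_cong)
      fix x
      have "?U x * ?g x = (indicator E x * ?g x) * (\<Sum>k. ennreal (\<alpha> (i + int k) x) * nn_cond_exp M (F (i + int k)) w' x)"
        by (simp add: nn_T_tail_def mult_ac)
      then show "?U x * ?g x = (\<Sum>k. (indicator E x * ennreal (\<alpha> (i + int k) x) * ?g x) * nn_cond_exp M (F (i + int k)) w' x)"
        by (simp only: ennreal_suminf_cmult[symmetric] mult_ac)
    qed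
    also have "\<dots> = (\<Sum>k. \<integral>\<^sup>+x. (indicator E x * ennreal (\<alpha> (i + int k) x) * ?g x) * nn_cond_exp M (F (i + int k)) w' x \<partial>M)"
      by (rule nn_integral_suminf) measurable
    also have "\<dots> = (\<Sum>k. \<integral>\<^sup>+x. (indicator E x * ennreal (\<alpha> (i + int k) x) * nn_cond_exp M (F (i + int k)) ?g x) * w' x \<partial>M)"
    proof (rule suminf_cong)
      fix k
      interpret S: sigma_finite_subalgebra M "F (i + int k)" by (rule sigma_finite_sub)
      note admissible_measurable[OF \<alpha>, measurable]
      \<comment> \<open>Only times from i on occur, so E stays measurable. Hence the conditional
        expectation can first be put on g and then be removed from w.\<close>
      have [measurable]: "E \<in> sets (F (i + int k))"
        using E filtered[of i "i + int k"] by (cases "k = 0") (auto simp: finite_sets_def)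
      have "(\<integral>\<^sup>+x. (indicator E x * ennreal (\<alpha> (i + int k) x) * nn_cond_exp M (F (i + int k)) w' x) * ?g x \<partial>M)
          = (\<integral>\<^sup>+x. (indicator E x * ennreal (\<alpha> (i + int k) x) * nn_cond_exp M (F (i + int k)) w' x)
              * nn_cond_exp M (F (i + int k)) ?g x \<partial>M)"
        by (rule S.nn_cond_exp_intg[symmetric]) measurable
      also have "\<dots> = (\<integral>\<^sup>+x. (indicator E x * ennreal (\<alpha> (i + int k) x) * nn_cond_exp M (F (i + int k)) ?g x)
              * nn_cond_exp M (F (i + int k)) w' x \<partial>M)"
        by (simp only: mult_ac)
      also have "\<dots> = (\<integral>\<^sup>+x. (indicator E x * ennreal (\<alpha> (i + int k) x) * nn_cond_exp M (F (i + int k)) ?g x) * w' x \<partial>M)"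
        by (rule S.nn_cond_exp_intg) measurable
      finally show "(\<integral>\<^sup>+x. (indicator E x * ennreal (\<alpha> (i + int k) x) * ?g x) * nn_cond_exp M (F (i + int k)) w' x \<partial>M)
          = (\<integral>\<^sup>+x. (indicator E x * ennreal (\<alpha> (i + int k) x) * nn_cond_exp M (F (i + int k)) ?g x) * w' x \<partial>M)"
        by (simp only: mult_ac)
    qed
    also have "\<dots> = (\<integral>\<^sup>+x. (\<Sum>k. (indicator E x * ennreal (\<alpha> (i + int k) x) * nn_cond_exp M (F (i + int k)) ?g x) * w' x) \<partial>M)"
      by (rule nn_integral_suminf[symmetric]) measurable
    also have "\<dots> = (\<integral>\<^sup>+x. w' x * (indicator E x * nn_T_tail \<alpha> i ?g x) \<partial>M)"
      by (simp add: nn_T_tail_def mult_ac)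
    also have "\<dots> = (\<integral>\<^sup>+x. indicator E x * nn_T_tail \<alpha> i ?g x \<partial>?\<nu>)"
      by (rule nn_integral_density[symmetric]) measurable
    also have "\<dots> \<le> enn_powr (\<integral>\<^sup>+x. enn_powr (indicator E x) (conj_exp q) \<partial>?\<nu>) (1 / conj_exp q)
        * enn_powr (\<integral>\<^sup>+x. enn_powr (nn_T_tail \<alpha> i ?g x) q \<partial>?\<nu>) (1 / q)"
      using inverse_add_inverse_conj_exp[OF q]
      by (intro nn_integral_Holder conj_exp_gt_1 q) (auto simp: add.commute)
    also have "(\<lambda>x. enn_powr (indicator E x) (conj_exp q)) = indicator E"
      by (auto simp: enn_powr_def split: split_indicator)
    also have "integral\<^sup>N ?\<nu> (indicator E) = emeasure ?\<nu> E" by simp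
    also have "enn_powr (emeasure ?\<nu> E) (1 / conj_exp q) * enn_powr (\<integral>\<^sup>+x. enn_powr (nn_T_tail \<alpha> i ?g x) q \<partial>?\<nu>) (1 / q)
        \<le> enn_powr (emeasure ?\<nu> E) (1 / conj_exp q) * (ennreal C * Lp_norm p M g)"
      by (intro mult_left_mono T_norm) simp
    finally show "(\<integral>\<^sup>+x. ?U x * ?g x \<partial>M) \<le> ennreal C * enn_powr (emeasure ?\<nu> E) (1 / conj_exp q)
        * enn_powr (\<integral>\<^sup>+x. enn_powr (?g x) (conj_exp (conj_exp p)) \<partial>M) (1 / conj_exp (conj_exp p))"
      unfolding conj_exp_conj_exp[OF p] norm_g by (simp only: mult_ac)
  qed measurable
  moreover have "(\<integral>\<^sup>+x. enn_powr (?U x) (conj_exp p) \<partial>M) = (\<integral>\<^sup>+x\<in>E. enn_powr (nn_T_tail \<alpha> i w' x) (conj_exp p) \<partial>M)"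
    by (intro nn_integral_cong) (auto split: split_indicator)
  ultimately show "enn_powr (\<integral>\<^sup>+x\<in>E. enn_powr (nn_T_tail \<alpha> i (\<lambda>x. ennreal (w x)) x) (conj_exp p) \<partial>M) (1 / conj_exp p)
      \<le> ennreal C * enn_powr (emeasure (density M (\<lambda>x. ennreal (w x))) E) (1 / conj_exp q)"
    unfolding w'_def by simp
qed

text \<open>Duality for the weighted measure reduces this to \<open>bilinear_bound\<close> for the
  filtration started at i; the constant does not depend on i.\<close>

lemma nn_T_tail_bound:
  assumes \<alpha>: "admissible M F \<alpha>" and w: "w \<in> weights M F" and p: "1 < p" and pq: "p \<le> q"
    and coeff: "\<And>i. nat_filtration_coeff M (\<lambda>n. F (i + int n)) (\<lambda>n x. ennreal (\<alpha> (i + int n) x)) c"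
    and testing: "testing_condition M F \<alpha> p q w C"
    and [measurable]: "f \<in> borel_measurable M"
  defines "K \<equiv> nat_filtration_coeff.bilinear_const c p (conj_exp q) (conj_exp p) (conj_exp p / conj_exp q)"
  shows "enn_powr (\<integral>\<^sup>+x. enn_powr (nn_T_tail \<alpha> i f x) q \<partial>density M (\<lambda>x. ennreal (w x))) (1 / q)
    \<le> K * ennreal C * enn_powr (\<integral>\<^sup>+x. enn_powr (f x) p \<partial>M) (1 / p)"
proof -
  define w' where "w' = (\<lambda>x. ennreal (w x))"
  let ?\<nu> = "density M w'"
  let ?s = "conj_exp p" and ?r = "conj_exp q" and ?u = "conj_exp p / conj_exp q"
  have q: "1 < q" using p pq by simp
  have s: "1 < ?s" and r: "1 < ?r" using p q by (auto intro: conj_exp_gt_1)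
  have u: "1 \<le> ?u" using conj_exp_antimono[OF p pq] r by simp
  have [measurable]: "w \<in> borel_measurable M" using w by (rule weights_measurable)
  have [measurable]: "w' \<in> borel_measurable M" unfolding w'_def by measurable
  note nn_T_tail_measurable[OF \<alpha>, measurable]
  interpret \<nu>: sigma_finite_filtered_measure ?\<nu> F
    unfolding w'_def by (rule filtered_density[OF w])
  interpret C: nat_filtration_coeff M "\<lambda>n. F (i + int n)" "\<lambda>n x. ennreal (\<alpha> (i + int n) x)" c
    by (rule coeff)
  let ?\<alpha> = "\<lambda>n x. ennreal (\<alpha> (i + int n) x)"
  have tail: "C.tail_op ?\<alpha> n h = nn_T_tail \<alpha> (i + int n) h" for n h
    by (rule ext) (rule nn_T_tail_eq_tail_op[symmetric])
  show ?thesis unfolding w'_def[symmetric]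
  proof (rule \<nu>.Lp_norm_le_by_duality[OF _ q])
    fix g :: "'a \<Rightarrow> real" assume "g \<in> borel_measurable ?\<nu>"
    then have [measurable]: "g \<in> borel_measurable M" by simp
    have "(\<integral>\<^sup>+x. nn_T_tail \<alpha> i f x * ennreal (g x) \<partial>?\<nu>) = (\<integral>\<^sup>+x. C.tail_op ?\<alpha> 0 f x * (w' x * ennreal (g x)) \<partial>M)"
      unfolding tail by (subst nn_integral_density) (auto simp: mult_ac)
    also have "\<dots> \<le> K * enn_powr (enn_powr (ennreal C) ?s) (1 / ?s)
       * enn_powr (\<integral>\<^sup>+x. enn_powr (f x) p \<partial>M) (1 / p)
       * enn_powr (\<integral>\<^sup>+x. enn_powr (ennreal (g x)) ?r \<partial>?\<nu>) (1 / ?r)"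
      unfolding K_def
    proof (rule C.bilinear_bound)
      show "nat_filtration ?\<nu> (\<lambda>n. F (i + int n))" by (rule \<nu>.nat_filtration_shift)
      show "?s = ?r * ?u" using r by simp
      fix k E assume E: "E \<in> sets (F (i + int k))"
      show "(\<integral>\<^sup>+x\<in>E. enn_powr (C.tail_op ?\<alpha> k w' x) ?s \<partial>M) \<le> enn_powr (ennreal C) ?s * enn_powr (emeasure ?\<nu> E) ?u"
      proof (rule sigma_finite_subalgebra.set_nn_integral_le_powr_extend[OF sigma_finite_sub _ _ _ _ E])
        fix E assume E: "E \<in> finite_sets M (F (i + int k))"
        have "enn_powr (\<integral>\<^sup>+x\<in>E. enn_powr (nn_T_tail \<alpha> (i + int k) w' x) ?s \<partial>M) (1 / ?s)
            \<le> ennreal C * enn_powr (emeasure ?\<nu> E) (1 / ?r)"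
          using testing E unfolding testing_condition_iff[OF \<alpha> w] w'_def by blast
        \<comment> \<open>The power p' gives the test with constant
          \<open>enn_powr (ennreal C) ?s\<close> and exponent \<open>?u\<close>, since (1 / q') p' =
          \<open>?u\<close>.\<close>
        then have "(\<integral>\<^sup>+x\<in>E. enn_powr (nn_T_tail \<alpha> (i + int k) w' x) ?s \<partial>M)
            \<le> enn_powr (ennreal C * enn_powr (emeasure ?\<nu> E) (1 / ?r)) ?s"
          using s by (simp add: enn_powr_le_iff)
        then show "(\<integral>\<^sup>+x\<in>E. enn_powr (C.tail_op ?\<alpha> k w' x) ?s \<partial>M) \<le> enn_powr (ennreal C) ?s * enn_powr (emeasure ?\<nu> E) ?u"
          unfolding tail by (simp add: enn_powr_mult enn_powr_powr)
      qed (use u in \<open>auto simp: tail\<close>)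
    qed (use p r u in auto)
    finally show "(\<integral>\<^sup>+x. nn_T_tail \<alpha> i f x * ennreal (g x) \<partial>?\<nu>)
        \<le> K * ennreal C * enn_powr (\<integral>\<^sup>+x. enn_powr (f x) p \<partial>M) (1 / p)
          * enn_powr (\<integral>\<^sup>+x. enn_powr (ennreal (g x)) ?r \<partial>?\<nu>) (1 / ?r)"
      using s by simp
  qed measurable
qed

text \<open>As the start tends to minus infinity, the tails for |f| increase to V, whose norm
  inherits the uniform bound. So V is finite almost everywhere for the weighted measure, which gives
  absolute convergence, and V dominates the absolute value of \<open>T_op\<close>.\<close>

lemma testing_imp_strong_type:
  assumes \<alpha>: "admissible M F \<alpha>" and w: "w \<in> weights M F" and p: "1 < p" and pq: "p \<le> q"
    and coeff: "\<And>i. nat_filtration_coeff M (\<lambda>n. F (i + int n)) (\<lambda>n x. ennreal (\<alpha> (i + int n) x)) c"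
    and testing: "testing_condition M F \<alpha> p q w C" and "0 < C"
    and K: "nat_filtration_coeff.bilinear_const c p (conj_exp q) (conj_exp p) (conj_exp p / conj_exp q) \<le> ennreal K"
    and "0 < K"
  shows "strong_type M F \<alpha> p q w (K * C)"
  unfolding strong_type_def
proof (intro ballI)
  fix f assume f: "f \<in> Lp_space p M"
  let ?\<nu> = "density M (\<lambda>x. ennreal (w x))"
  let ?f = "\<lambda>x. ennreal \<bar>f x\<bar>"
  have q: "1 < q" using p pq by simp
  have [measurable]: "f \<in> borel_measurable M" using f by (simp add: Lp_space_def)
  have [measurable]: "w \<in> borel_measurable M" using w by (rule weights_measurable)
  note nn_T_tail_measurable[OF \<alpha>, measurable]
  define V where "V x = (SUP N. nn_T_tail \<alpha> (- int N) ?f x)" for x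
  have [measurable]: "V \<in> borel_measurable M" unfolding V_def by measurable
  have "(\<integral>\<^sup>+x. enn_powr (V x) q \<partial>?\<nu>) = (\<integral>\<^sup>+x. (SUP N. enn_powr (nn_T_tail \<alpha> (- int N) ?f x) q) \<partial>?\<nu>)"
    unfolding V_def using q by (simp add: enn_powr_SUP)
  also have "\<dots> = (SUP N. \<integral>\<^sup>+x. enn_powr (nn_T_tail \<alpha> (- int N) ?f x) q \<partial>?\<nu>)"
  proof (rule nn_integral_monotone_convergence_SUP)
    show "incseq (\<lambda>N x. enn_powr (nn_T_tail \<alpha> (- int N) ?f x) q)"
      using q by (intro incseq_SucI le_funI enn_powr_mono nn_T_tail_mono_index) auto
  qed measurable
  also have "\<dots> \<le> enn_powr (ennreal (K * C) * Lp_norm p M f) q"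
  proof (rule SUP_least)
    fix N
    have "enn_powr (\<integral>\<^sup>+x. enn_powr (nn_T_tail \<alpha> (- int N) ?f x) q \<partial>?\<nu>) (1 / q)
      \<le> nat_filtration_coeff.bilinear_const c p (conj_exp q) (conj_exp p) (conj_exp p / conj_exp q) * ennreal C * Lp_norm p M f"
      unfolding Lp_norm_eq by (rule nn_T_tail_bound[OF \<alpha> w p pq coeff testing]) measurable
    also have "\<dots> \<le> ennreal K * ennreal C * Lp_norm p M f"
      by (intro mult_right_mono K) auto
    also have "ennreal K * ennreal C = ennreal (K * C)"
      using \<open>0 < K\<close> \<open>0 < C\<close> by (simp add: ennreal_mult)
    finally show "(\<integral>\<^sup>+x. enn_powr (nn_T_tail \<alpha> (- int N) ?f x) q \<partial>?\<nu>) \<le> enn_powr (ennreal (K * C) * Lp_norm p M f) q"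
      using q by (simp add: enn_powr_le_iff)
  qed
  finally have V_le: "(\<integral>\<^sup>+x. enn_powr (V x) q \<partial>?\<nu>) \<le> enn_powr (ennreal (K * C) * Lp_norm p M f) q" .
  have "ennreal (K * C) * Lp_norm p M f < top"
    using f by (simp add: Lp_space_def ennreal_mult_less_top)
  then have "(\<integral>\<^sup>+x. enn_powr (V x) q \<partial>?\<nu>) \<noteq> \<infinity>"
    using V_le by (auto simp: top_unique)
  then have V_fin: "AE x in ?\<nu>. enn_powr (V x) q \<noteq> \<infinity>"
    by (intro nn_integral_PInf_AE) measurable
  have "AE x in M. \<forall>j. ennreal \<bar>real_cond_exp M (F j) f x\<bar> \<le> nn_cond_exp M (F j) ?f x"
    by (intro AE_all_countable[THEN iffD2] allI sigma_finite_subalgebra.real_cond_exp_abs[OF sigma_finite_sub]) measurable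
  then have "AE x in ?\<nu>. \<forall>j. ennreal \<bar>real_cond_exp M (F j) f x\<bar> \<le> nn_cond_exp M (F j) ?f x"
    by (subst AE_density) auto
  then have both: "AE x in ?\<nu>. (\<lambda>i. \<alpha> i x * real_cond_exp M (F i) f x) summable_on UNIV \<and>
      ennreal \<bar>T_op M F \<alpha> f x\<bar> \<le> V x"
    using V_fin AE_space
  proof eventually_elim
    case (elim x)
    have nonneg: "0 \<le> \<alpha> j x" for j using elim admissible_nonneg[OF \<alpha>] by simp
    obtain v where v: "V x = ennreal v" "0 \<le> v" using elim by (cases "V x") auto
    have "(\<Sum>k. ennreal \<bar>\<alpha> (- int N + int k) x * real_cond_exp M (F (- int N + int k)) f x\<bar>) \<le> ennreal v" for N
    proof -
      have "(\<Sum>k. ennreal \<bar>\<alpha> (- int N + int k) x * real_cond_exp M (F (- int N + int k)) f x\<bar>)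
          \<le> nn_T_tail \<alpha> (- int N) ?f x"
        unfolding nn_T_tail_def
        using elim nonneg by (intro suminf_le) (auto simp: abs_mult ennreal_mult intro!: mult_left_mono)
      also have "\<dots> \<le> V x" unfolding V_def by (rule SUP_upper) simp
      finally show ?thesis using v by simp
    qed
    note * = summable_on_int_if_tails_bounded[of "\<lambda>j. \<alpha> j x * real_cond_exp M (F j) f x", OF this v(2)]
    show ?case
      using * v by (auto simp: T_op_def intro!: ennreal_leI)
  qed
  show "(AE x in ?\<nu>. (\<lambda>i. \<alpha> i x * real_cond_exp M (F i) f x) summable_on UNIV) \<and>
      Lp_norm q ?\<nu> (T_op M F \<alpha> f) \<le> ennreal (K * C) * Lp_norm p M f"
  proof
    show "AE x in ?\<nu>. (\<lambda>i. \<alpha> i x * real_cond_exp M (F i) f x) summable_on UNIV"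
      using both by eventually_elim simp
    have "(\<integral>\<^sup>+x. enn_powr (ennreal \<bar>T_op M F \<alpha> f x\<bar>) q \<partial>?\<nu>) \<le> (\<integral>\<^sup>+x. enn_powr (V x) q \<partial>?\<nu>)"
    proof (rule nn_integral_mono_AE)
      show "AE x in ?\<nu>. enn_powr (ennreal \<bar>T_op M F \<alpha> f x\<bar>) q \<le> enn_powr (V x) q"
        using both by eventually_elim (use q in \<open>auto intro: enn_powr_mono\<close>)
    qed
    also note V_le
    finally show "Lp_norm q ?\<nu> (T_op M F \<alpha> f) \<le> ennreal (K * C) * Lp_norm p M f"
      unfolding Lp_norm_eq[of q] using q by (simp add: enn_powr_le_iff)
  qed
qed

end

theorem theorem1p1:
  fixes M :: "'a measure" and F :: "int \<Rightarrow> 'a measure"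
    and \<alpha> :: "int \<Rightarrow> 'a \<Rightarrow> real" and p q :: real
  assumes "sigma_finite_filtered_measure M F"
    and "1 < p" and "p \<le> q"
    and "admissible M F \<alpha>"
  shows "\<exists>K>0. \<forall>w \<in> weights M F.
    ((\<exists>C\<^sub>1>0. strong_type M F \<alpha> p q w C\<^sub>1) \<longleftrightarrow> (\<exists>C\<^sub>2>0. testing_condition M F \<alpha> p q w C\<^sub>2)) \<and>
    ((\<exists>C\<^sub>1>0. strong_type M F \<alpha> p q w C\<^sub>1) \<longrightarrow>
       Inf {C\<^sub>1. C\<^sub>1 > 0 \<and> strong_type M F \<alpha> p q w C\<^sub>1}
         \<le> K * Inf {C\<^sub>2. C\<^sub>2 > 0 \<and> testing_condition M F \<alpha> p q w C\<^sub>2} \<and>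
       Inf {C\<^sub>2. C\<^sub>2 > 0 \<and> testing_condition M F \<alpha> p q w C\<^sub>2}
         \<le> K * Inf {C\<^sub>1. C\<^sub>1 > 0 \<and> strong_type M F \<alpha> p q w C\<^sub>1})"
proof -
  interpret sigma_finite_filtered_measure M F by fact
  note p = \<open>1 < p\<close> and pq = \<open>p \<le> q\<close> and \<alpha> = \<open>admissible M F \<alpha>\<close>
  have q: "1 < q" using p pq by simp
  obtain c where "0 < c" and c: "\<And>i. AE x in M. alpha_bar \<alpha> i x / c \<le> real_cond_exp M (F i) (alpha_bar \<alpha> i) x \<and>
        real_cond_exp M (F i) (alpha_bar \<alpha> i) x \<le> c * alpha_bar \<alpha> i x"
    using \<alpha> unfolding admissible_def by blast
  have coeff: "nat_filtration_coeff M (\<lambda>n. F (i + int n)) (\<lambda>n x. ennreal (\<alpha> (i + int n) x)) (ennreal c)" for i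
    by (rule nat_filtration_coeff_shift[OF \<alpha> \<open>0 < c\<close> c])
  let ?B = "nat_filtration_coeff.bilinear_const (ennreal c) p (conj_exp q) (conj_exp p) (conj_exp p / conj_exp q)"
  have "?B < top"
    unfolding nat_filtration_coeff.bilinear_const_def[OF coeff[of 0]] by (simp add: ennreal_mult_less_top)
  \<comment> \<open>K is fixed before any weight; the added 1 gives K >= 1, as the direction with
    equal constants requires.\<close>
  define K where "K = enn2real ?B + 1"
  have K: "1 \<le> K" and BK: "?B \<le> ennreal K"
    using \<open>?B < top\<close> by (auto simp: K_def less_top_ennreal)
  have to_testing: "testing_condition M F \<alpha> p q w C" if "w \<in> weights M F" "strong_type M F \<alpha> p q w C" for w C
    using strong_type_imp_testing[OF \<alpha> _ p q] that by blast
  have to_strong: "strong_type M F \<alpha> p q w (K * C)" if "w \<in> weights M F" "0 < C" "testing_condition M F \<alpha> p q w C" for w C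
    using testing_imp_strong_type[OF \<alpha> that(1) p pq coeff that(3,2) BK] K by simp
  show ?thesis
  proof (intro exI[of _ K] conjI ballI impI)
    show "0 < K" using K by simp
    fix w assume w: "w \<in> weights M F"
    let ?S = "{C. C > 0 \<and> strong_type M F \<alpha> p q w C}" and ?T = "{C. C > 0 \<and> testing_condition M F \<alpha> p q w C}"
    have sub: "?S \<subseteq> ?T" using to_testing[OF w] by auto
    have KT: "K * C \<in> ?S" if "C \<in> ?T" for C using to_strong[OF w, of C] that K by auto
    show "(\<exists>C\<^sub>1>0. strong_type M F \<alpha> p q w C\<^sub>1) \<longleftrightarrow> (\<exists>C\<^sub>2>0. testing_condition M F \<alpha> p q w C\<^sub>2)"
      using sub KT by blast
    assume "\<exists>C\<^sub>1>0. strong_type M F \<alpha> p q w C\<^sub>1"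
    \<comment> \<open>An infimum of reals is informative only for a nonempty set bounded
      below.\<close>
    then have ne: "?S \<noteq> {}" "?T \<noteq> {}" using sub by auto
    have bdd: "bdd_below ?S" "bdd_below ?T" by (auto intro: bdd_belowI[of _ 0])
    \<comment> \<open>Multiplication by K maps \<open>?T\<close> into \<open>?S\<close>, so the
      left-hand side is a lower bound of \<open>?T\<close>.\<close>
    have "Inf ?S / K \<le> Inf ?T"
    proof (rule cInf_greatest[OF ne(2)])
      fix C assume "C \<in> ?T"
      then have "Inf ?S \<le> K * C" by (intro cInf_lower KT bdd)
      then show "Inf ?S / K \<le> C" using K by (simp add: field_simps)
    qed
    then show "Inf ?S \<le> K * Inf ?T" using K by (simp add: field_simps)
    have "0 \<le> Inf ?S" by (rule cInf_greatest[OF ne(1)]) auto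
    then have "Inf ?S \<le> K * Inf ?S" using K by (simp add: mult_le_cancel_right1)
    moreover have "Inf ?T \<le> Inf ?S" by (rule cInf_superset_mono[OF ne(1) bdd(2) sub])
    ultimately show "Inf ?T \<le> K * Inf ?S" by simp
  qed
qed

end
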